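(* Let $n\ge 1$. There is a constant $C$ depending only on $n$ such that the following holds. Let $\Omega\subset\mathbb{R}^n$ be an open set, and let $U$ belong to the tent space $\mathcal{T}^1(\mathbb{R}^n\times\mathbb{R}^+)$ with $\operatorname{supp}(U)\subset T(\Omega)$. Then there are a countable (possibly finite or empty) family of scalars $\lambda_k\in\mathbb{C}$, balls $B_k\subset\mathbb{R}^n$ with radius $r_k$, and measurable functions $A_k$ on $\mathbb{R}^n\times\mathbb{R}^+$ such that $$U=\sum_k\lambda_kA_k\ \text{ in } \mathcal{T}^1(\mathbb{R}^n\times\mathbb{R}^+),\qquad \sum_k|\lambda_k|\le C\,\|U\|_{\mathcal{T}^1(\mathbb{R}^n\times\mathbb{R}^+)},$$ and for every $k$: $$\operatorname{supp}(A_k)\subset B_k\times(0,6r_k),\qquad 5B_k\subset\Omega,\qquad |B_k|\int_0^\infty\!\!\int_{\mathbb{R}^n}|A_k(y,t)|^2\,dy\,\frac{dt}{t}=1 .$$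
   Context: $\mathbb{R}^+=(0,\infty)$. For a ball $B$, $|B|$ denotes its volume, and for $c>0$, $cB$ is the ball with the same centre and $c$ times the radius. For $x\in\mathbb{R}^n$ let $\Gamma'(x)=\{(y,t)\in\mathbb{R}^n\times\mathbb{R}^+: |y-x|<t\}$. For a measurable function $U$ on $\mathbb{R}^n\times\mathbb{R}^+$ (complex valued) put $$(SU)(x)=\Big(\iint_{\Gamma'(x)}|U(y,t)|^2\,\frac{dy\,dt}{t^{n+1}}\Big)^{1/2}.$$ The tent space $\mathcal{T}^1(\mathbb{R}^n\times\mathbb{R}^+)$ is the set of all measurable $U$ with $\|U\|_{\mathcal{T}^1(\mathbb{R}^n\times\mathbb{R}^+)}:=\|SU\|_{L^1(\mathbb{R}^n)}<\infty$. The tent over an open set $\Omega$ is $T(\Omega)=\{(y,t)\in\mathbb{R}^n\times\mathbb{R}^+: d(y,\Omega^c)\ge t\}$, where $d$ is Euclidean distance and $\Omega^c=\mathbb{R}^n\setminus\Omega$ (with $d(y,\emptyset)=\infty$). For a measurable function $F$ on $\mathbb{R}^n\times\mathbb{R}^+$, "$\operatorname{supp}F\subset E$" means that $F=0$ almost everywhere outside $E$. *)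

theory Defs
  imports "HOL-Analysis.Analysis"
begin

definition upper_half :: "('a \<times> real) set" where
  "upper_half = UNIV \<times> {0<..}"

text \<open>
  Functions on the upper half-space are total functions on \<open>(real ^ 'n) \<times> real\<close>; their values
  for \<open>t \<le> 0\<close> play no role. Measurable means Lebesgue measurable.
\<close>

definition halfspace_measurable :: "((real ^ 'n) \<times> real \<Rightarrow> complex) \<Rightarrow> bool" where
  "halfspace_measurable U \<longleftrightarrow> U \<in> borel_measurable (lebesgue_on upper_half)"

definition supp_subset ::
    "((real ^ 'n) \<times> real \<Rightarrow> complex) \<Rightarrow> ((real ^ 'n) \<times> real) set \<Rightarrow> bool" where
  "supp_subset F E \<longleftrightarrow> (AE z in lebesgue_on upper_half. z \<notin> E \<longrightarrow> F z = 0)"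

definition aperture_cone :: "real ^ 'n \<Rightarrow> ((real ^ 'n) \<times> real) set" where
  "aperture_cone x = {(y, t). 0 < t \<and> dist y x < t}"

definition ennreal_sqrt :: "ennreal \<Rightarrow> ennreal" where
  "ennreal_sqrt a = (if a = \<infinity> then \<infinity> else ennreal (sqrt (enn2real a)))"

definition square_fun :: "((real ^ 'n) \<times> real \<Rightarrow> complex) \<Rightarrow> real ^ 'n \<Rightarrow> ennreal" where
  "square_fun U x =
     ennreal_sqrt (\<integral>\<^sup>+ (y, t) \<in> aperture_cone x. ennreal ((cmod (U (y, t)))\<^sup>2 / t ^ (CARD('n) + 1)) \<partial>lebesgue)"

definition tent_norm :: "((real ^ 'n) \<times> real \<Rightarrow> complex) \<Rightarrow> ennreal" where
  "tent_norm U = (\<integral>\<^sup>+ x. square_fun U x \<partial>lebesgue)"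

definition tent_space :: "((real ^ 'n) \<times> real \<Rightarrow> complex) set" where
  "tent_space = {U. halfspace_measurable U \<and> tent_norm U < \<infinity>}"

text \<open>
  The case \<open>\<Omega> = UNIV\<close> is separate because \<open>infdist y {} = 0\<close>, whereas the distance to the
  empty set is here understood to be infinite.
\<close>

definition tent :: "(real ^ 'n) set \<Rightarrow> ((real ^ 'n) \<times> real) set" where
  "tent \<Omega> = {(y, t). 0 < t \<and> (\<Omega> = UNIV \<or> t \<le> infdist y (- \<Omega>))}"

text \<open>
  Unordered summation in the tent space, as in \<^const>\<open>has_sum\<close>, with the tent norm in place
  of the norm of a type.
\<close>

definition has_tent_sum ::
    "('i \<Rightarrow> (real ^ 'n) \<times> real \<Rightarrow> complex) \<Rightarrow> ((real ^ 'n) \<times> real \<Rightarrow> complex) \<Rightarrow> 'i set \<Rightarrow> bool" where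
  "has_tent_sum f U K \<longleftrightarrow>
     U \<in> tent_space \<and> (\<forall>k\<in>K. f k \<in> tent_space) \<and>
     ((\<lambda>F. tent_norm (\<lambda>z. U z - (\<Sum>k\<in>F. f k z))) \<longlongrightarrow> 0) (finite_subsets_at_top K)"

end

theory Submission
  imports Defs
begin

text \<open>
  The atoms are pieces of \<open>U\<close> itself, cut out by the size of \<open>SU\<close>. For an integer \<open>k\<close> let
  \<open>O\<^sub>k = {SU > 2\<^sup>k}\<close> (\<open>level\<close> below), and let \<open>E\<^sub>k\<close> be the set of all \<open>(y, t)\<close> such that \<open>O\<^sub>k\<close> fills
  more than half of the ball \<open>B(y, t)\<close> (\<open>dense_balls\<close> of the level). The sets \<open>E\<^sub>k\<close> decrease
  in \<open>k\<close>, and almost every point at which \<open>U\<close> does not vanish lies in exactly one layer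
  \<open>E\<^sub>k - E\<^sub>k\<^sub>+\<^sub>1\<close> (\<open>dyadic_layers_cover_support\<close>).

  Off \<open>E\<^sub>k\<^sub>+\<^sub>1\<close> the energy of \<open>U\<close> is controlled: at least half of the \<open>x \<in> B(y, t)\<close>, that is, half
  of the cones with vertex \<open>x\<close> that contain \<open>(y, t)\<close>, satisfy \<open>SU(x) \<le> 2\<^sup>k\<^sup>+\<^sup>1\<close>, and integrating over
  these vertices turns \<open>\<integral> \<bar>U\<bar>\<^sup>2 dy dt / t\<close> into \<open>\<integral> (SU)\<^sup>2 dx\<close> (\<open>averaging_estimate\<close>). Over a box
  \<open>B \<times> (0, 6r)\<close> only vertices in \<open>7B\<close> matter, so the energy there is at most
  \<open>C 4\<^sup>k \<bar>B\<bar>\<close> (\<open>dyadic_box_energy\<close>), and the piece of \<open>U\<close> in the box is an atom with a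
  coefficient at most \<open>C 2\<^sup>k \<bar>B\<bar>\<close>.

  The boxes come from the open set \<open>W\<^sub>k\<close>, the union of the balls \<open>B(y, t)\<close> with
  \<open>(y, t) \<in> E\<^sub>k \<inter> T(\<Omega>)\<close> (\<open>dense_hull\<close>). A point of \<open>T(\<Omega>)\<close> carries a ball inside \<open>\<Omega>\<close>, so
  \<open>W\<^sub>k \<subseteq> \<Omega>\<close>; this is what keeps the atoms inside \<open>\<Omega>\<close>, which the super-level sets of a maximal
  function would not do. By the Vitali covering lemma \<open>\<bar>W\<^sub>k\<bar> \<le> C \<bar>O\<^sub>k\<bar>\<close>. A Whitney covering of \<open>W\<^sub>k\<close> by
  balls \<open>B(c, d(c) / 5)\<close>, with \<open>d\<close> the distance to the complement of \<open>W\<^sub>k\<close>, has total measure at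
  most \<open>C \<bar>W\<^sub>k\<bar>\<close>, satisfies \<open>5B \<subseteq> W\<^sub>k\<close>, and its boxes cover \<open>E\<^sub>k \<inter> T(\<Omega>)\<close>: if \<open>y \<in> B\<close> and
  \<open>B(y, t) \<subseteq> W\<^sub>k\<close>, then \<open>t \<le> d(y) < d(c) + r = 6r\<close> (\<open>whitney_covering\<close>). Summing the coefficients
  over all balls and all \<open>k\<close> gives \<open>C \<Sum>\<^sub>k 2\<^sup>k \<bar>O\<^sub>k\<bar> \<le> 2C \<integral> SU\<close>.

  The pieces are made disjoint, so the remainder after finitely many of them is \<open>U\<close> restricted to
  a smaller set. Convergence in the tent norm is then dominated convergence, applied first in the
  cones and then to the square functions (\<open>has_tent_sum_partition\<close>).
\<close>

section \<open>Square functions and their measurability\<close>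

definition cone_energy :: "((real ^ 'n) \<times> real \<Rightarrow> complex) \<Rightarrow> real ^ 'n \<Rightarrow> ennreal" where
  "cone_energy U x =
     (\<integral>\<^sup>+ z. ennreal ((cmod (U z))\<^sup>2 / snd z ^ (CARD('n) + 1)) * indicator (aperture_cone x) z \<partial>lborel)"

text \<open>
  The pairs \<open>(y, t)\<close> such that the set fills more than half of the ball \<open>B(y, t)\<close>. The
  uncentred maximal function of the indicator of the set exceeds one half on the union of these
  balls.
\<close>
definition dense_balls :: "(real ^ 'n) set \<Rightarrow> ((real ^ 'n) \<times> real) set" where
  "dense_balls H = {(y, t). 0 < t \<and> emeasure lborel (ball y t) < 2 * emeasure lborel (ball y t \<inter> H)}"

lemma square_fun_eq_sqrt_cone_energy: "square_fun U x = ennreal_sqrt (cone_energy U x)"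
  unfolding square_fun_def cone_energy_def nn_integral_completion
  by (simp add: case_prod_beta')

lemma ennreal_sqrt_power2: "(ennreal_sqrt a)\<^sup>2 = a"
proof (cases a)
  case (real r)
  then show ?thesis
    by (simp add: ennreal_sqrt_def ennreal_power)
next
  case top
  then show ?thesis
    by (simp add: ennreal_sqrt_def power2_eq_square ennreal_mult_top)
qed

lemma square_fun_power2: "(square_fun U x)\<^sup>2 = cone_energy U x"
  by (simp add: square_fun_eq_sqrt_cone_energy ennreal_sqrt_power2)

lemma ennreal_sqrt_mono: "a \<le> b \<Longrightarrow> ennreal_sqrt a \<le> ennreal_sqrt b"
  by (auto simp: ennreal_sqrt_def top_unique intro!: ennreal_leI real_sqrt_le_mono enn2real_mono
      simp: less_top)

lemma ennreal_sqrt_measurable [measurable]: "ennreal_sqrt \<in> borel_measurable borel"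
  unfolding ennreal_sqrt_def [abs_def] by measurable

lemma ennreal_sqrt_tendsto_0:
  assumes "(f \<longlongrightarrow> 0) F"
  shows "((\<lambda>i. ennreal_sqrt (f i)) \<longlongrightarrow> 0) F"
proof -
  have "((\<lambda>i. enn2real (f i)) \<longlongrightarrow> 0) F"
    using tendsto_enn2real [of f 0 F] assms by simp
  then have "((\<lambda>i. ennreal (sqrt (enn2real (f i)))) \<longlongrightarrow> ennreal (sqrt 0)) F"
    by (intro tendsto_ennrealI tendsto_real_sqrt)
  moreover have "\<forall>\<^sub>F i in F. f i < top"
    using order_tendstoD(2)[OF assms, of top] by simp
  then have "\<forall>\<^sub>F i in F. ennreal (sqrt (enn2real (f i))) = ennreal_sqrt (f i)"
    by eventually_elim (auto simp: ennreal_sqrt_def)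
  ultimately show ?thesis
    using tendsto_cong by fastforce
qed

lemma upper_half_borel [measurable]: "upper_half \<in> sets (borel :: ((real ^ 'n) \<times> real) measure)"
  unfolding upper_half_def by (intro borel_open open_Times) auto

lemma aperture_cone_iff: "z \<in> aperture_cone x \<longleftrightarrow> 0 < snd z \<and> dist (fst z) x < snd z"
  by (cases z) (simp add: aperture_cone_def)

text \<open>
  The measurability prover treats \<open>fst\<close> and \<open>snd\<close> as maps on product \<open>\<sigma>\<close>-algebras. These two
  rules serve the Borel \<open>\<sigma>\<close>-algebra of a product space, over which the half-space integrals run.
\<close>
lemma measurable_fst_borel [measurable (raw)]:
  fixes f :: "'c \<Rightarrow> 'a :: topological_space \<times> 'b :: topological_space"
  shows "f \<in> borel_measurable M \<Longrightarrow> (\<lambda>x. fst (f x)) \<in> borel_measurable M"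
  by (rule measurable_compose[OF _ borel_measurable_continuous_onI[OF continuous_on_fst[OF continuous_on_id]]])

lemma measurable_snd_borel [measurable (raw)]:
  fixes f :: "'c \<Rightarrow> 'a :: topological_space \<times> 'b :: topological_space"
  shows "f \<in> borel_measurable M \<Longrightarrow> (\<lambda>x. snd (f x)) \<in> borel_measurable M"
  by (rule measurable_compose[OF _ borel_measurable_continuous_onI[OF continuous_on_snd[OF continuous_on_id]]])

lemma indicator_aperture_cone_measurable [measurable (raw)]:
  fixes f :: "'c \<Rightarrow> (real ^ 'n) \<times> real" and g :: "'c \<Rightarrow> real ^ 'n"
  assumes [measurable]: "f \<in> borel_measurable M" "g \<in> borel_measurable M"
  shows "(\<lambda>x. indicator (aperture_cone (g x)) (f x) :: ennreal) \<in> borel_measurable M"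
proof -
  define X where "X = {p :: ((real ^ 'n) \<times> real) \<times> (real ^ 'n). fst p \<in> aperture_cone (snd p)}"
  have "open X"
    unfolding X_def aperture_cone_iff
    by (intro open_Collect_conj open_Collect_less continuous_intros)
  then have "(\<lambda>x. indicator X (f x, g x) :: ennreal) \<in> borel_measurable M"
    by (intro measurable_compose[OF borel_measurable_Pair[OF assms]]) simp
  then show ?thesis
    by (simp add: X_def indicator_def)
qed

lemma cone_energy_measurable [measurable]:
  fixes U :: "(real ^ 'n) \<times> real \<Rightarrow> complex"
  assumes [measurable]: "U \<in> borel_measurable borel"
  shows "cone_energy U \<in> borel_measurable borel"
proof -
  have "(\<lambda>x. \<integral>\<^sup>+ z. ennreal ((cmod (U z))\<^sup>2 / snd z ^ (CARD('n) + 1)) *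
          indicator (aperture_cone x) z \<partial>lborel) \<in> borel_measurable lborel"
    by measurable
  then show ?thesis
    unfolding cone_energy_def [abs_def] by simp
qed

lemma square_fun_measurable [measurable]:
  assumes [measurable]: "U \<in> borel_measurable borel"
  shows "square_fun U \<in> borel_measurable borel"
  unfolding square_fun_eq_sqrt_cone_energy [abs_def] by measurable

lemma ball_Int_measure_measurable [measurable]:
  fixes H :: "(real ^ 'n) set"
  assumes [measurable]: "H \<in> sets borel"
  shows "(\<lambda>z. emeasure lborel (ball (fst z) (snd z) \<inter> H)) \<in> borel_measurable (borel :: ((real ^ 'n) \<times> real) measure)"
proof -
  have "(\<lambda>z. \<integral>\<^sup>+ x. indicator (aperture_cone x) z * indicator H x \<partial>lborel)
        \<in> borel_measurable (lborel :: ((real ^ 'n) \<times> real) measure)"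
    by measurable
  moreover have "(\<integral>\<^sup>+ x. indicator (aperture_cone x) z * indicator H x \<partial>lborel)
      = emeasure lborel (ball (fst z) (snd z) \<inter> H)" for z :: "(real ^ 'n) \<times> real"
  proof -
    have "(\<integral>\<^sup>+ x. indicator (aperture_cone x) z * indicator H x \<partial>lborel)
       = (\<integral>\<^sup>+ x. indicator (ball (fst z) (snd z) \<inter> H) x \<partial>lborel)"
      by (intro nn_integral_cong)
         (auto simp: indicator_def aperture_cone_iff dest: le_less_trans[OF zero_le_dist])
    then show ?thesis by simp
  qed
  ultimately show ?thesis by simp
qed

lemma dense_balls_borel [measurable]:
  fixes H :: "(real ^ 'n) set"
  assumes [measurable]: "H \<in> sets borel"
  shows "dense_balls H \<in> sets borel"
proof -
  have "dense_balls H = {z \<in> space borel. 0 < snd z \<and>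
      emeasure lborel (ball (fst z) (snd z) \<inter> UNIV) < 2 * emeasure lborel (ball (fst z) (snd z) \<inter> H)}"
    by (auto simp: dense_balls_def)
  also have "\<dots> \<in> sets borel"
    by measurable
  finally show ?thesis .
qed

lemma tent_borel [measurable]:
  assumes "open (\<Omega> :: (real ^ 'n) set)"
  shows "tent \<Omega> \<in> sets borel"
proof -
  have "tent \<Omega> = upper_half \<inter> {z. \<Omega> = UNIV \<or> snd z \<le> infdist (fst z) (- \<Omega>)}"
    by (auto simp: tent_def upper_half_def)
  moreover have "closed {z :: (real ^ 'n) \<times> real. snd z \<le> infdist (fst z) (- \<Omega>)}"
    by (intro closed_Collect_le continuous_intros)
  ultimately show ?thesis
    by (cases "\<Omega> = UNIV") (auto simp: upper_half_borel)
qed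

lemma ball_emeasure:
  fixes y :: "real ^ 'n"
  shows "0 \<le> t \<Longrightarrow> emeasure lborel (ball y t) = ennreal (unit_ball_vol (real CARD('n)) * t ^ CARD('n))"
  by (simp add: emeasure_ball)

section \<open>Averaging over the vertices of cones\<close>

text \<open>
  If \<open>H\<close> fills half of \<open>B(y, t)\<close>, then \<open>t\<^sup>n\<close> is at most a constant times the measure of those
  \<open>x \<in> H\<close> whose cone contains \<open>(y, t)\<close>. Hence \<open>1 / t\<close> is at most that constant times
  \<open>\<integral>\<^sub>H 1[(y, t) \<in> \<Gamma>(x)] dx / t\<^sup>n\<^sup>+\<^sup>1\<close>, and Tonelli's theorem exchanges the integrals.
\<close>
lemma averaging_estimate:
  fixes U :: "(real ^ 'n) \<times> real \<Rightarrow> complex"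
  assumes [measurable]: "U \<in> borel_measurable borel" "H \<in> sets borel" "Q \<in> sets borel"
    and Q: "\<And>y t. (y, t) \<in> Q \<Longrightarrow> 0 < t \<and> emeasure lborel (ball y t) \<le> 2 * emeasure lborel (ball y t \<inter> H)"
  shows "(\<integral>\<^sup>+ z. ennreal ((cmod (U z))\<^sup>2 / snd z) * indicator Q z \<partial>lborel)
     \<le> ennreal (2 / unit_ball_vol (real CARD('n))) * (\<integral>\<^sup>+ x. cone_energy U x * indicator H x \<partial>lborel)"
proof -
  define \<omega> where "\<omega> = unit_ball_vol (real CARD('n))"
  define g where "g z = ennreal ((cmod (U z))\<^sup>2 / snd z ^ (CARD('n) + 1))" for z
  have [measurable]: "g \<in> borel_measurable borel"
    unfolding g_def [abs_def] by measurable
  have \<omega>: "\<omega> > 0" by (simp add: \<omega>_def)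
  have "ennreal ((cmod (U z))\<^sup>2 / snd z) * indicator Q z
     \<le> ennreal (2 / \<omega>) * (\<integral>\<^sup>+ x. g z * indicator (aperture_cone x) z * indicator H x \<partial>lborel)" (is "_ \<le> ?R") for z
  proof (cases "z \<in> Q")
    case True
    obtain y t where z: "z = (y, t)" by (cases z)
    have t: "0 < t" and le: "emeasure lborel (ball y t) \<le> 2 * emeasure lborel (ball y t \<inter> H)"
      using Q True z by auto
    have "(\<integral>\<^sup>+ x. g z * indicator (aperture_cone x) z * indicator H x \<partial>lborel)
        = (\<integral>\<^sup>+ x. g z * indicator (ball y t \<inter> H) x \<partial>lborel)"
      using t by (intro nn_integral_cong) (auto simp: indicator_def z aperture_cone_iff)
    also have "\<dots> = g z * emeasure lborel (ball y t \<inter> H)"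
      by (simp add: nn_integral_cmult_indicator)
    moreover have two: "ennreal (2 / \<omega>) = 2 * ennreal (1 / \<omega>)"
      using \<omega> by (simp flip: ennreal_mult ennreal_numeral)
    ultimately have R: "?R = ennreal (1 / \<omega>) * g z * (2 * emeasure lborel (ball y t \<inter> H))"
      by (simp add: two mult_ac)
    have "(cmod (U z))\<^sup>2 / t = 1 / \<omega> * ((cmod (U z))\<^sup>2 / t ^ (CARD('n) + 1)) * (\<omega> * t ^ CARD('n))"
      using t \<omega> by (simp add: field_simps)
    then have "ennreal ((cmod (U z))\<^sup>2 / snd z) = ennreal (1 / \<omega>) * g z * emeasure lborel (ball y t)"
      using t \<omega> unfolding g_def by (simp add: z ball_emeasure \<omega>_def[symmetric] flip: ennreal_mult)
    also have "\<dots> \<le> ?R"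
      unfolding R by (intro mult_left_mono le) auto
    finally show ?thesis using True by simp
  qed auto
  then have "(\<integral>\<^sup>+ z. ennreal ((cmod (U z))\<^sup>2 / snd z) * indicator Q z \<partial>lborel)
     \<le> (\<integral>\<^sup>+ z. ennreal (2 / \<omega>) * (\<integral>\<^sup>+ x. g z * indicator (aperture_cone x) z * indicator H x \<partial>lborel) \<partial>lborel)"
    by (intro nn_integral_mono) auto
  also have "\<dots> = ennreal (2 / \<omega>) * (\<integral>\<^sup>+ z. (\<integral>\<^sup>+ x. g z * indicator (aperture_cone x) z * indicator H x \<partial>lborel) \<partial>lborel)"
    by (intro nn_integral_cmult) measurable
  also have "(\<integral>\<^sup>+ z. (\<integral>\<^sup>+ x. g z * indicator (aperture_cone x) z * indicator H x \<partial>lborel) \<partial>lborel)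
      = (\<integral>\<^sup>+ x. (\<integral>\<^sup>+ z. g z * indicator (aperture_cone x) z * indicator H x \<partial>lborel) \<partial>lborel)"
    by (rule lborel_pair.Fubini'[symmetric]) measurable
  also have "\<dots> = (\<integral>\<^sup>+ x. cone_energy U x * indicator H x \<partial>lborel)"
  proof (intro nn_integral_cong)
    fix x
    have "(\<integral>\<^sup>+ z. g z * indicator (aperture_cone x) z * indicator H x \<partial>lborel)
        = (\<integral>\<^sup>+ z. g z * indicator (aperture_cone x) z \<partial>lborel) * indicator H x"
      by (intro nn_integral_multc) measurable
    then show "(\<integral>\<^sup>+ z. g z * indicator (aperture_cone x) z * indicator H x \<partial>lborel) = cone_energy U x * indicator H x"
      by (simp add: cone_energy_def g_def)
  qed
  finally show ?thesis by (simp add: \<omega>_def)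
qed

section \<open>Vitali and Whitney coverings\<close>

text \<open>
  Continuity from below along an enumeration of the index set; bounds on finite sums are the form in
  which the disjoint balls of a covering lemma are used.
\<close>
lemma emeasure_UN_le_if_finite_sums_le:
  assumes C: "countable C" and X: "\<And>i. i \<in> C \<Longrightarrow> X i \<in> sets M"
    and le: "\<And>F. finite F \<Longrightarrow> F \<subseteq> C \<Longrightarrow> (\<Sum>i\<in>F. emeasure M (X i)) \<le> m"
  shows "emeasure M (\<Union>i\<in>C. X i) \<le> m"
proof -
  define F where "F N = {i \<in> C. to_nat_on C i < N}" for N
  have fin: "finite (F N)" for N
  proof (rule finite_imageD)
    show "finite (to_nat_on C ` F N)"
      by (rule finite_subset [of _ "{..<N}"]) (auto simp: F_def)
    show "inj_on (to_nat_on C) (F N)"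
      by (rule inj_on_subset [OF inj_on_to_nat_on[OF C]]) (auto simp: F_def)
  qed
  have union: "(\<Union>i\<in>C. X i) = (\<Union>N. \<Union>i\<in>F N. X i)"
    by (auto simp: F_def)
  have sup: "(SUP N. emeasure M (\<Union>i\<in>F N. X i)) = emeasure M (\<Union>N. \<Union>i\<in>F N. X i)"
  proof (rule SUP_emeasure_incseq)
    show "range (\<lambda>N. \<Union>i\<in>F N. X i) \<subseteq> sets M"
      using X fin by (auto simp: F_def intro!: sets.finite_UN)
    show "incseq (\<lambda>N. \<Union>i\<in>F N. X i)"
      by (auto simp: incseq_def F_def)
  qed
  have "emeasure M (\<Union>i\<in>F N. X i) \<le> m" for N
  proof -
    have "emeasure M (\<Union>i\<in>F N. X i) \<le> (\<Sum>i\<in>F N. emeasure M (X i))"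
      using X fin by (intro emeasure_subadditive_finite) (auto simp: F_def)
    also have "\<dots> \<le> m"
      using fin by (intro le) (auto simp: F_def)
    finally show ?thesis .
  qed
  then show ?thesis
    unfolding union sup[symmetric] by (rule SUP_least)
qed

text \<open>
  The Vitali lemma asks for bounded radii. A ball of measure at most \<open>m\<close> has
  \<open>t \<le> 1\<close> or \<open>\<omega> t \<le> \<omega> t\<^sup>n \<le> m\<close>, which avoids taking an \<open>n\<close>-th root.
\<close>
lemma radius_le_of_ball_measure_le:
  fixes y :: "real ^ 'n"
  assumes "emeasure lborel (ball y t) \<le> ennreal m" "0 \<le> m"
  shows "t \<le> 1 + m / unit_ball_vol (real CARD('n))"
proof (cases "t \<le> 1")
  case True
  then show ?thesis using assms(2) by (simp add: add_increasing2)
next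
  case False
  define \<omega> where "\<omega> = unit_ball_vol (real CARD('n))"
  have \<omega>: "\<omega> > 0" by (simp add: \<omega>_def)
  have "\<omega> * t \<le> \<omega> * t ^ CARD('n)"
    using \<omega> False by (intro mult_left_mono self_le_power) auto
  also have "\<dots> \<le> m"
    using assms False by (simp add: ball_emeasure \<omega>_def)
  finally have "t \<le> m / \<omega>"
    using \<omega> by (simp add: field_simps)
  then show ?thesis by (simp add: \<omega>_def)
qed

lemma ball_emeasure_scale:
  fixes y :: "real ^ 'n"
  assumes "0 \<le> a" "0 \<le> t"
  shows "emeasure lborel (ball y (a * t)) = ennreal (a ^ CARD('n)) * emeasure lborel (ball y t)"
  using assms by (simp add: ball_emeasure power_mult_distrib mult_ac flip: ennreal_mult)

text \<open>
  The weak-type estimate behind the maximal theorem: by Vitali the union is covered by the fivefold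
  enlargements of disjoint balls of the family, and at least half of the measure of each of these
  lies in \<open>H\<close>.
\<close>
lemma dense_balls_union_measure:
  fixes H :: "(real ^ 'n) set"
  assumes [measurable]: "H \<in> sets borel" and fin: "emeasure lborel H < \<infinity>" and G: "G \<subseteq> dense_balls H"
  shows "emeasure lborel (\<Union>(y, t)\<in>G. ball y t) \<le> ennreal (2 * 5 ^ CARD('n)) * emeasure lborel H"
proof -
  obtain m where m: "emeasure lborel H = ennreal m" "0 \<le> m"
    using fin by (cases "emeasure lborel H") auto
  have pos: "0 < snd i" and dense: "emeasure lborel (ball (fst i) (snd i)) \<le> 2 * emeasure lborel (ball (fst i) (snd i) \<inter> H)"
    if "i \<in> G" for i
    using that G by (auto simp: dense_balls_def)
  have bd: "snd i \<le> 1 + 2 * m / unit_ball_vol (real CARD('n))" if "i \<in> G" for i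
  proof -
    have "2 * emeasure lborel (ball (fst i) (snd i) \<inter> H) \<le> 2 * emeasure lborel H"
      by (intro mult_left_mono emeasure_mono) auto
    also have "\<dots> = ennreal (2 * m)"
      using m by (simp add: ennreal_mult)
    finally show ?thesis
      using dense[OF that] m by (intro radius_le_of_ball_measure_le[of "fst i"]) auto
  qed
  obtain C where C: "countable C" "C \<subseteq> G"
     "pairwise (\<lambda>i j. disjnt (ball (fst i) (snd i)) (ball (fst j) (snd j))) C"
     "(\<Union>i\<in>G. ball (fst i) (snd i)) \<subseteq> (\<Union>i\<in>C. ball (fst i) (5 * snd i))"
    by (rule Vitali_covering_lemma_balls[of "\<Union>i\<in>G. ball (fst i) (snd i)" fst snd G
          "1 + 2 * m / unit_ball_vol (real CARD('n))"]) (use pos bd in auto)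
  have "emeasure lborel (\<Union>(y, t)\<in>G. ball y t) \<le> emeasure lborel (\<Union>i\<in>C. ball (fst i) (5 * snd i))"
    using C(1,4) by (intro emeasure_mono) (auto simp: case_prod_beta' intro!: borel_open open_UN)
  also have "\<dots> \<le> ennreal (2 * 5 ^ CARD('n)) * emeasure lborel H"
  proof (rule emeasure_UN_le_if_finite_sums_le[OF C(1)])
    fix F assume F: "finite F" "F \<subseteq> C"
    have "(\<Sum>i\<in>F. emeasure lborel (ball (fst i) (5 * snd i)))
       = ennreal (5 ^ CARD('n)) * (\<Sum>i\<in>F. emeasure lborel (ball (fst i) (snd i)))"
      unfolding sum_distrib_left
      using F C(2) pos by (intro sum.cong ball_emeasure_scale) (auto intro!: less_imp_le)
    also have "\<dots> \<le> ennreal (5 ^ CARD('n)) * (\<Sum>i\<in>F. 2 * emeasure lborel (ball (fst i) (snd i) \<inter> H))"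
      using F C(2) dense by (intro mult_left_mono sum_mono) auto
    also have "\<dots> = ennreal (2 * 5 ^ CARD('n)) * (\<Sum>i\<in>F. emeasure lborel (ball (fst i) (snd i) \<inter> H))"
      by (simp add: ennreal_mult mult_ac flip: sum_distrib_left)
    also have "(\<Sum>i\<in>F. emeasure lborel (ball (fst i) (snd i) \<inter> H)) = emeasure lborel (\<Union>i\<in>F. ball (fst i) (snd i) \<inter> H)"
    proof (rule sum_emeasure)
      show "disjoint_family_on (\<lambda>i. ball (fst i) (snd i) \<inter> H) F"
        using C(3) F(2) unfolding disjoint_family_on_def pairwise_def disjnt_def by blast
    qed (use F in auto)
    also have "\<dots> \<le> emeasure lborel H"
      by (intro emeasure_mono) auto
    finally show "(\<Sum>i\<in>F. emeasure lborel (ball (fst i) (5 * snd i))) \<le> ennreal (2 * 5 ^ CARD('n)) * emeasure lborel H"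
      by (simp add: mult_left_mono)
  qed auto
  finally show ?thesis .
qed

lemma le_infdist_compl_if_ball_subset:
  assumes "ball y t \<subseteq> W" "-W \<noteq> {}"
  shows "t \<le> infdist y (- W)"
proof -
  have "t \<le> dist y x" if "x \<in> -W" for x
    using assms that by (meson ComplD mem_ball not_le subsetD)
  then show ?thesis
    using assms(2) by (auto simp: infdist_def intro!: cINF_greatest)
qed

text \<open>
  The radii \<open>d(c) / 25\<close> are passed to the Vitali lemma so that its fivefold enlargements have radius
  \<open>d(c) / 5\<close>, whose fivefold enlargements in turn still lie in \<open>W\<close>. The height bound holds since
  \<open>d\<close> is 1-Lipschitz: on the ball with centre \<open>c\<close> and radius \<open>d(c) / 5\<close> it stays strictly below
  \<open>6 d(c) / 5\<close>. Finite measure of \<open>W\<close> enters twice, to bound the radii and to make its complement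
  nonempty, so that \<open>infdist\<close> is the distance.
\<close>
lemma whitney_covering:
  fixes W :: "(real ^ 'n) set"
  assumes W: "open W" and fin: "emeasure lborel W < \<infinity>"
  obtains C where "countable C"
    "\<And>c. c \<in> C \<Longrightarrow> 0 < infdist c (- W) \<and> ball c (infdist c (- W)) \<subseteq> W"
    "\<And>y t. ball y t \<subseteq> W \<Longrightarrow> y \<in> W \<Longrightarrow> \<exists>c\<in>C. y \<in> ball c (infdist c (- W) / 5) \<and> t < 6 * (infdist c (- W) / 5)"
    "\<And>F. finite F \<Longrightarrow> F \<subseteq> C \<Longrightarrow>
       (\<Sum>c\<in>F. emeasure lborel (ball c (infdist c (- W) / 5))) \<le> ennreal (5 ^ CARD('n)) * emeasure lborel W"
proof -
  define d where "d c = infdist c (- W)" for c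
  obtain m where m: "emeasure lborel W = ennreal m" "0 \<le> m"
    using fin by (cases "emeasure lborel W") auto
  have ne: "- W \<noteq> {}"
  proof
    assume "- W = {}"
    then have "W = UNIV" by auto
    then show False using fin by simp
  qed
  have pos: "0 < d c" if "c \<in> W" for c
    using that W ne unfolding d_def by (intro infdist_pos_not_in_closed) auto
  have sub: "ball c (d c) \<subseteq> W" for c
  proof
    fix x assume "x \<in> ball c (d c)"
    then have "\<not> infdist c (- W) \<le> dist c x" by (simp add: d_def)
    then show "x \<in> W" using infdist_le[of x "- W" c] by blast
  qed
  have bd: "d c \<le> 1 + m / unit_ball_vol (real CARD('n))" for c
    using sub[of c] m W by (intro radius_le_of_ball_measure_le[of c]) (auto simp: m(1)[symmetric] intro!: emeasure_mono)
  obtain C where C: "countable C" "C \<subseteq> W"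
     "pairwise (\<lambda>i j. disjnt (ball i (d i / 25)) (ball j (d j / 25))) C"
     "W \<subseteq> (\<Union>i\<in>C. ball i (5 * (d i / 25)))"
  proof (rule Vitali_covering_lemma_balls[of W "\<lambda>i. i" "\<lambda>i. d i / 25" W "1 + m / unit_ball_vol (real CARD('n))"])
    show "W \<subseteq> (\<Union>i\<in>W. ball i (d i / 25))"
      using pos by force
    show "0 < d i / 25 \<and> d i / 25 \<le> 1 + m / unit_ball_vol (real CARD('n))" if "i \<in> W" for i
    proof -
      have "d i / 25 \<le> d i" using pos[OF that] by simp
      then show ?thesis using pos[OF that] bd[of i] by linarith
    qed
  qed (use that in auto)
  show thesis
  proof (rule that[OF C(1)])
    show "0 < infdist c (- W) \<and> ball c (infdist c (- W)) \<subseteq> W" if "c \<in> C" for c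
      using pos[of c] sub[of c] C(2) that by (auto simp: d_def)
    show "\<exists>c\<in>C. y \<in> ball c (infdist c (- W) / 5) \<and> t < 6 * (infdist c (- W) / 5)"
      if y: "ball y t \<subseteq> W" "y \<in> W" for y t
    proof -
      obtain c where c: "c \<in> C" "dist c y < d c / 5"
        using C(4) y(2) by auto
      have "t \<le> d y"
        unfolding d_def by (rule le_infdist_compl_if_ball_subset[OF y(1) ne])
      also have "\<dots> \<le> d c + dist y c"
        unfolding d_def by (rule infdist_triangle)
      also have "\<dots> < 6 * (d c / 5)"
        using c(2) by (simp add: dist_commute)
      finally show ?thesis
        using c by (auto simp: d_def)
    qed
    show "(\<Sum>c\<in>F. emeasure lborel (ball c (infdist c (- W) / 5))) \<le> ennreal (5 ^ CARD('n)) * emeasure lborel W"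
      if F: "finite F" "F \<subseteq> C" for F
    proof -
      have "(\<Sum>c\<in>F. emeasure lborel (ball c (d c / 5)))
          = ennreal (5 ^ CARD('n)) * (\<Sum>c\<in>F. emeasure lborel (ball c (d c / 25)))"
        unfolding sum_distrib_left
        using ball_emeasure_scale[of 5 "d c / 25" c for c] by (intro sum.cong) (auto simp: d_def infdist_nonneg)
      also have "(\<Sum>c\<in>F. emeasure lborel (ball c (d c / 25))) = emeasure lborel (\<Union>c\<in>F. ball c (d c / 25))"
      proof (rule sum_emeasure)
        show "disjoint_family_on (\<lambda>c. ball c (d c / 25)) F"
          using C(3) F(2) unfolding disjoint_family_on_def pairwise_def disjnt_def by blast
      qed (use F in auto)
      also have "\<dots> \<le> emeasure lborel W"
      proof (intro emeasure_mono)
        have "ball c (d c / 25) \<subseteq> ball c (d c)" for c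
          by (rule subset_ball) (simp add: d_def infdist_nonneg)
        then show "(\<Union>c\<in>F. ball c (d c / 25)) \<subseteq> W"
          using sub by blast
      qed (use W in auto)
      finally show ?thesis by (simp add: d_def mult_left_mono)
    qed
  qed
qed

section \<open>Dyadic sums\<close>

lemma sum_powi_le:
  fixes F :: "int set"
  assumes "finite F" "\<And>k. k \<in> F \<Longrightarrow> k \<le> b"
  shows "(\<Sum>k\<in>F. (2::real) powi k) \<le> 2 * 2 powi b"
  using assms
proof (induction F arbitrary: b rule: finite_linorder_max_induct)
  case empty
  then show ?case by simp
next
  case (insert a F)
  have "(\<Sum>k\<in>F. (2::real) powi k) \<le> 2 * 2 powi (a - 1)"
    using insert.hyps by (intro insert.IH) force
  also have "\<dots> = 2 powi a"
    by (simp add: power_int_diff)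
  finally have "(\<Sum>k\<in>insert a F. (2::real) powi k) \<le> 2 * 2 powi a"
    using insert.hyps by (subst sum.insert) auto
  also have "\<dots> \<le> 2 * 2 powi b"
    using insert.prems by (intro mult_left_mono power_int_increasing) auto
  finally show ?case .
qed

text \<open>
  The powers of two below \<open>s\<close> form a geometric progression, dominated by twice its largest term.
  Integrated over \<open>s = SU(x)\<close> this gives the dyadic layer-cake bound \<open>\<Sum> 2\<^sup>k \<bar>O\<^sub>k\<bar> \<le> 2 \<integral> SU\<close>.
\<close>
lemma sum_dyadic_below_le:
  fixes s :: ennreal
  assumes "finite F"
  shows "(\<Sum>k\<in>F. ennreal (2 powi k) * indicator {ennreal (2 powi k)<..} s) \<le> 2 * s"
proof -
  define G where "G = {k \<in> F. ennreal (2 powi k) < s}"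
  have "(\<Sum>k\<in>F. ennreal (2 powi k) * indicator {ennreal (2 powi k)<..} s) = (\<Sum>k\<in>G. ennreal (2 powi k))"
    unfolding G_def using assms by (intro sum.mono_neutral_cong_right) (auto simp: indicator_def)
  also have "\<dots> = ennreal (\<Sum>k\<in>G. 2 powi k)"
    by (intro sum_ennreal) auto
  also have "\<dots> \<le> 2 * s"
  proof (cases "G = {}")
    case False
    have fG: "finite G" using assms by (simp add: G_def)
    have "ennreal (\<Sum>k\<in>G. 2 powi k) \<le> ennreal (2 * 2 powi (Max G))"
      using fG by (intro ennreal_leI sum_powi_le) auto
    also have "\<dots> = 2 * ennreal (2 powi (Max G))"
      by (simp add: ennreal_mult)
    also have "\<dots> \<le> 2 * s"
      using Max_in[OF fG False] by (intro mult_left_mono) (auto simp: G_def)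
    finally show ?thesis .
  qed simp
  finally show ?thesis .
qed

section \<open>Convergence in the tent norm\<close>

lemma cone_energy_mono:
  assumes "\<And>z. z \<in> upper_half \<Longrightarrow> cmod (U z) \<le> cmod (V z)"
  shows "cone_energy U x \<le> cone_energy V x"
  unfolding cone_energy_def
proof (intro nn_integral_mono)
  fix z :: "(real ^ 'a) \<times> real"
  show "ennreal ((cmod (U z))\<^sup>2 / snd z ^ (CARD('a) + 1)) * indicator (aperture_cone x) z
      \<le> ennreal ((cmod (V z))\<^sup>2 / snd z ^ (CARD('a) + 1)) * indicator (aperture_cone x) z"
    using assms[of z]
    by (auto simp: indicator_def aperture_cone_iff upper_half_def mem_Times_iff
        intro!: ennreal_leI divide_right_mono power_mono)
qed

lemma square_fun_mono:
  assumes "\<And>z. z \<in> upper_half \<Longrightarrow> cmod (U z) \<le> cmod (V z)"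
  shows "square_fun U x \<le> square_fun V x"
  unfolding square_fun_eq_sqrt_cone_energy
  by (intro ennreal_sqrt_mono cone_energy_mono assms)

lemma tent_norm_eq: "tent_norm U = (\<integral>\<^sup>+ x. square_fun U x \<partial>lborel)"
  unfolding tent_norm_def nn_integral_completion ..

lemma tent_norm_mono:
  assumes "\<And>z. z \<in> upper_half \<Longrightarrow> cmod (U z) \<le> cmod (V z)"
  shows "tent_norm U \<le> tent_norm V"
  unfolding tent_norm_eq by (intro nn_integral_mono square_fun_mono assms)

lemma square_fun_cong_AE:
  assumes "AE z in lborel. z \<in> upper_half \<longrightarrow> U z = V z"
  shows "square_fun U x = square_fun V x"
  unfolding square_fun_eq_sqrt_cone_energy cone_energy_def
  by (intro arg_cong[of _ _ ennreal_sqrt] nn_integral_cong_AE)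
     (use assms in eventually_elim, auto simp: indicator_def aperture_cone_iff upper_half_def mem_Times_iff)

lemma tent_norm_cong_AE:
  assumes "AE z in lborel. z \<in> upper_half \<longrightarrow> U z = V z"
  shows "tent_norm U = tent_norm V"
  unfolding tent_norm_eq square_fun_cong_AE[OF assms] ..

lemma halfspace_measurable_borel:
  "U \<in> borel_measurable borel \<Longrightarrow> halfspace_measurable U"
  unfolding halfspace_measurable_def
  by (intro measurable_restrict_space1 measurable_completion) simp

lemma has_tent_sum_cong_AE:
  assumes "has_tent_sum f V K" "U \<in> tent_space" "AE z in lborel. z \<in> upper_half \<longrightarrow> U z = V z"
  shows "has_tent_sum f U K"
proof -
  have "tent_norm (\<lambda>z. U z - (\<Sum>k\<in>F. f k z)) = tent_norm (\<lambda>z. V z - (\<Sum>k\<in>F. f k z))" for F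
    using assms(3) by (intro tent_norm_cong_AE) (rule eventually_mono, auto)
  then show ?thesis
    using assms(1,2) by (simp add: has_tent_sum_def)
qed

lemma has_tent_sum_cong:
  assumes "\<And>k z. k \<in> K \<Longrightarrow> f k z = g k z"
  shows "has_tent_sum f U K \<longleftrightarrow> has_tent_sum g U K"
proof -
  have "\<forall>k\<in>K. f k = g k"
    using assms by (auto simp: fun_eq_iff)
  moreover have "\<forall>\<^sub>F F in finite_subsets_at_top K.
      tent_norm (\<lambda>z. U z - (\<Sum>k\<in>F. f k z)) = tent_norm (\<lambda>z. U z - (\<Sum>k\<in>F. g k z))"
    using eventually_finite_subsets_at_top_weakI[of K "\<lambda>F. F \<subseteq> K"]
  proof (rule eventually_mono)
    fix F assume "F \<subseteq> K"
    then have "(\<Sum>k\<in>F. f k z) = (\<Sum>k\<in>F. g k z)" for z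
      by (intro sum.cong refl assms) auto
    then show "tent_norm (\<lambda>z. U z - (\<Sum>k\<in>F. f k z)) = tent_norm (\<lambda>z. U z - (\<Sum>k\<in>F. g k z))"
      by simp
  qed auto
  ultimately show ?thesis
    unfolding has_tent_sum_def by (auto cong: tendsto_cong)
qed

lemma cone_energy_finite_AE:
  assumes [measurable]: "U \<in> borel_measurable borel" and fin: "tent_norm U < \<infinity>"
  shows "AE x in lborel. cone_energy U x < \<infinity>"
proof -
  have "AE x in lborel. square_fun U x \<noteq> \<infinity>"
    using fin by (intro nn_integral_PInf_AE) (auto simp: tent_norm_eq)
  then show ?thesis
    by eventually_elim (auto simp: less_top power2_eq_square ennreal_mult_less_top simp flip: square_fun_power2)
qed

text \<open>
  Dominated convergence twice: inside almost every cone, where the energy of \<open>U\<close> is finite, and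
  then for the square functions, which are dominated by the integrable function \<open>SU\<close>.
\<close>
lemma tent_norm_tendsto_0:
  fixes U :: "(real ^ 'n) \<times> real \<Rightarrow> complex"
  assumes [measurable]: "U \<in> borel_measurable borel" "\<And>m. V m \<in> borel_measurable borel"
    and fin: "tent_norm U < \<infinity>"
    and le: "\<And>m z. cmod (V m z) \<le> cmod (U z)"
    and lim: "AE z in lborel. z \<in> upper_half \<longrightarrow> (\<lambda>m. V m z) \<longlonglongrightarrow> 0"
  shows "(\<lambda>m. tent_norm (V m)) \<longlonglongrightarrow> 0"
proof -
  have cone: "(\<lambda>m. cone_energy (V m) x) \<longlonglongrightarrow> 0" if x: "cone_energy U x < \<infinity>" for x
  proof -
    define u where "u V z = ennreal ((cmod (V z))\<^sup>2 / snd z ^ (CARD('n) + 1)) * indicator (aperture_cone x) z"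
      for V :: "(real ^ 'n) \<times> real \<Rightarrow> complex" and z
    have "(\<lambda>m. \<integral>\<^sup>+ z. u (V m) z \<partial>lborel) \<longlonglongrightarrow> (\<integral>\<^sup>+ z. 0 \<partial>(lborel :: ((real ^ 'n) \<times> real) measure))"
    proof (rule nn_integral_dominated_convergence[where w = "u U"])
      show "(\<integral>\<^sup>+ z. u U z \<partial>lborel) < \<infinity>"
        using x by (simp add: cone_energy_def u_def)
      show "AE z in lborel. u (V j) z \<le> u U z" for j
        using le[of j] by (intro AE_I2)
          (auto simp: u_def indicator_def aperture_cone_iff intro!: ennreal_leI divide_right_mono power_mono)
      show "AE z in lborel. (\<lambda>m. u (V m) z) \<longlonglongrightarrow> 0"
        using lim
      proof eventually_elim
        case (elim z)
        show ?case
        proof (cases "z \<in> aperture_cone x")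
          case True
          then have "z \<in> upper_half" "0 < snd z"
            by (auto simp: aperture_cone_iff upper_half_def mem_Times_iff)
          with elim have "(\<lambda>m. (cmod (V m z))\<^sup>2 / snd z ^ (CARD('n) + 1)) \<longlonglongrightarrow> (cmod 0)\<^sup>2 / snd z ^ (CARD('n) + 1)"
            by (intro tendsto_intros) auto
          then have "(\<lambda>m. ennreal ((cmod (V m z))\<^sup>2 / snd z ^ (CARD('n) + 1))) \<longlonglongrightarrow> ennreal 0"
            by (intro tendsto_ennrealI) simp
          then show ?thesis
            using True by (simp add: u_def)
        qed (simp add: u_def)
      qed
    qed (auto simp: u_def [abs_def])
    then show ?thesis
      by (simp add: cone_energy_def u_def)
  qed
  have "(\<lambda>m. \<integral>\<^sup>+ x. square_fun (V m) x \<partial>lborel) \<longlonglongrightarrow> (\<integral>\<^sup>+ x. 0 \<partial>(lborel :: (real ^ 'n) measure))"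
  proof (rule nn_integral_dominated_convergence[where w = "square_fun U"])
    show "AE x in lborel. square_fun (V j) x \<le> square_fun U x" for j
      using le by (intro AE_I2 square_fun_mono) auto
    show "(\<integral>\<^sup>+ x. square_fun U x \<partial>lborel) < \<infinity>"
      using fin by (simp add: tent_norm_eq)
    show "AE x in lborel. (\<lambda>m. square_fun (V m) x) \<longlonglongrightarrow> 0"
      using cone_energy_finite_AE[OF assms(1) fin]
      by eventually_elim (auto simp: square_fun_eq_sqrt_cone_energy intro!: ennreal_sqrt_tendsto_0 cone)
  qed auto
  then show ?thesis by (simp add: tent_norm_eq)
qed

text \<open>
  Since the pieces are disjoint, the remainder is \<open>U\<close> restricted to the complement of the pieces
  used so far. Its modulus decreases when pieces are added, so convergence along initial segments of
  \<open>K\<close> already gives convergence along all finite subsets.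
\<close>
lemma has_tent_sum_partition:
  fixes U :: "(real ^ 'n) \<times> real \<Rightarrow> complex" and Q :: "nat \<Rightarrow> ((real ^ 'n) \<times> real) set"
  assumes U [measurable]: "U \<in> borel_measurable borel" and fin: "tent_norm U < \<infinity>"
    and Q [measurable]: "\<And>k. Q k \<in> sets borel" and disj: "disjoint_family Q"
    and cover: "AE z in lborel. z \<in> upper_half \<longrightarrow> U z \<noteq> 0 \<longrightarrow> z \<in> (\<Union>k\<in>K. Q k)"
  shows "has_tent_sum (\<lambda>k z. if z \<in> Q k then U z else 0) U K"
proof -
  define R where "R F z = U z - (\<Sum>k\<in>F. if z \<in> Q k then U z else 0)" for F z
  have R: "R F z = (if z \<in> (\<Union>k\<in>F. Q k) then 0 else U z)" if "finite F" for F z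
  proof (cases "z \<in> (\<Union>k\<in>F. Q k)")
    case True
    then obtain k where k: "k \<in> F" "z \<in> Q k" by blast
    have "(\<Sum>j\<in>F. if z \<in> Q j then U z else 0) = (\<Sum>j\<in>{k}. if z \<in> Q j then U z else 0)"
    proof (rule sum.mono_neutral_right)
      show "\<forall>i\<in>F - {k}. (if z \<in> Q i then U z else 0) = 0"
        using disj k by (auto simp: disjoint_family_on_def)
    qed (use k that in auto)
    then show ?thesis using True k by (simp add: R_def)
  next
    case False
    then have "(\<Sum>j\<in>F. if z \<in> Q j then U z else 0) = 0"
      by (intro sum.neutral) auto
    then show ?thesis using False by (simp add: R_def)
  qed
  have mem: "V \<in> tent_space" if "V \<in> borel_measurable borel" "\<And>z. cmod (V z) \<le> cmod (U z)" for V
    using tent_norm_mono[of V U] that fin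
    by (auto simp: tent_space_def halfspace_measurable_borel intro: le_less_trans)
  have [measurable]: "R F \<in> borel_measurable borel" for F
    unfolding R_def [abs_def] by measurable
  have lim: "(\<lambda>m. tent_norm (R (K \<inter> {..<m}))) \<longlonglongrightarrow> 0"
  proof (rule tent_norm_tendsto_0[OF U _ fin])
    show "cmod (R (K \<inter> {..<m}) z) \<le> cmod (U z)" for m z
      by (simp add: R)
    show "AE z in lborel. z \<in> upper_half \<longrightarrow> (\<lambda>m. R (K \<inter> {..<m}) z) \<longlonglongrightarrow> 0"
      using cover
    proof eventually_elim
      case (elim z)
      show ?case
      proof
        assume "z \<in> upper_half"
        show "(\<lambda>m. R (K \<inter> {..<m}) z) \<longlonglongrightarrow> 0"
        proof (cases "U z = 0")
          case False
          then obtain k where k: "k \<in> K" "z \<in> Q k"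
            using elim \<open>z \<in> upper_half\<close> by auto
          have "R (K \<inter> {..<m}) z = 0" if "k < m" for m
            using k that by (auto simp: R)
          then have "\<forall>\<^sub>F m in sequentially. R (K \<inter> {..<m}) z = 0"
            by (rule eventually_mono[OF eventually_gt_at_top])
          then show ?thesis
            by (rule tendsto_eventually)
        qed (simp add: R cong: if_cong)
      qed
    qed
  qed auto
  have "((\<lambda>F. tent_norm (R F)) \<longlongrightarrow> 0) (finite_subsets_at_top K)"
  proof (rule order_tendstoI)
    fix e :: ennreal assume "0 < e"
    then have "\<forall>\<^sub>F m in sequentially. tent_norm (R (K \<inter> {..<m})) < e"
      using order_tendstoD(2)[OF lim] by auto
    then obtain m where m: "tent_norm (R (K \<inter> {..<m})) < e"
      by (auto simp: eventually_sequentially)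
    show "\<forall>\<^sub>F F in finite_subsets_at_top K. tent_norm (R F) < e"
      unfolding eventually_finite_subsets_at_top
    proof (intro exI conjI allI impI)
      fix F assume F: "finite F \<and> K \<inter> {..<m} \<subseteq> F \<and> F \<subseteq> K"
      then have "tent_norm (R F) \<le> tent_norm (R (K \<inter> {..<m}))"
        by (intro tent_norm_mono) (auto simp: R)
      then show "tent_norm (R F) < e" using m by simp
    qed auto
  qed auto
  then show ?thesis
    unfolding has_tent_sum_def R_def using mem by auto
qed

section \<open>Dyadic layers of a function on the half-space\<close>

definition level :: "((real ^ 'n) \<times> real \<Rightarrow> complex) \<Rightarrow> int \<Rightarrow> (real ^ 'n) set" where
  "level U k = {x. ennreal (2 powi k) < square_fun U x}"

lemma level_borel [measurable]:
  assumes [measurable]: "U \<in> borel_measurable borel"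
  shows "level U k \<in> sets borel"
proof -
  have "{x \<in> space borel. ennreal (2 powi k) < square_fun U x} \<in> sets borel"
    by measurable
  then show ?thesis by (simp add: level_def)
qed

lemma level_antimono: "j \<le> k \<Longrightarrow> level U k \<subseteq> level U j"
  unfolding level_def by (auto intro: le_less_trans[OF ennreal_leI[OF power_int_increasing]])

lemma dense_balls_mono:
  assumes "H \<subseteq> H'" and [measurable]: "H' \<in> sets borel"
  shows "dense_balls H \<subseteq> dense_balls H'"
proof -
  have "2 * emeasure lborel (ball y t \<inter> H) \<le> 2 * emeasure lborel (ball y t \<inter> H')" for y t
    using assms(1) by (intro mult_left_mono emeasure_mono) auto
  then show ?thesis
    by (auto simp: dense_balls_def intro: less_le_trans)
qed

lemma sum_level_measures_le:
  assumes [measurable]: "U \<in> borel_measurable borel" and F: "finite F"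
  shows "(\<Sum>k\<in>F. ennreal (2 powi k) * emeasure lborel (level U k)) \<le> 2 * tent_norm U"
proof -
  have "(\<Sum>k\<in>F. ennreal (2 powi k) * emeasure lborel (level U k))
      = (\<Sum>k\<in>F. \<integral>\<^sup>+ x. ennreal (2 powi k) * indicator (level U k) x \<partial>lborel)"
    by (intro sum.cong) (auto simp: nn_integral_cmult_indicator)
  also have "\<dots> = (\<integral>\<^sup>+ x. (\<Sum>k\<in>F. ennreal (2 powi k) * indicator (level U k) x) \<partial>lborel)"
    by (intro nn_integral_sum[symmetric]) measurable
  also have "\<dots> = (\<integral>\<^sup>+ x. (\<Sum>k\<in>F. ennreal (2 powi k) * indicator {ennreal (2 powi k)<..} (square_fun U x)) \<partial>lborel)"
    by (simp add: level_def indicator_def)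
  also have "\<dots> \<le> (\<integral>\<^sup>+ x. 2 * square_fun U x \<partial>lborel)"
    by (intro nn_integral_mono sum_dyadic_below_le F)
  also have "\<dots> = 2 * tent_norm U"
    unfolding tent_norm_eq by (intro nn_integral_cmult) measurable
  finally show ?thesis .
qed

text \<open>
  Chebyshev's inequality up to the factor 2, read off from \<open>sum_level_measures_le\<close>.
\<close>
lemma level_measure_le:
  assumes [measurable]: "U \<in> borel_measurable borel" and u: "tent_norm U = ennreal u" "0 \<le> u"
  shows "emeasure lborel (level U k) \<le> ennreal (2 * u / 2 powi k)"
proof -
  have le: "ennreal (2 powi k) * emeasure lborel (level U k) \<le> ennreal (2 * u)"
    using sum_level_measures_le[OF assms(1), of "{k}"] u by (simp add: ennreal_mult)
  show ?thesis
  proof (cases "emeasure lborel (level U k)")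
    case (real l)
    then show ?thesis
      using le u by (simp add: field_simps flip: ennreal_mult)
  next
    case top
    then show ?thesis using le by (simp add: ennreal_mult_top top_unique)
  qed
qed

lemma emeasure_le_double_Diff:
  assumes [measurable]: "B \<in> sets M" "H \<in> sets M" and fin: "emeasure M B < \<infinity>"
    and half: "2 * emeasure M (B \<inter> H) \<le> emeasure M B"
  shows "emeasure M B \<le> 2 * emeasure M (B - H)"
proof -
  have split: "emeasure M B = emeasure M (B \<inter> H) + emeasure M (B - H)"
    by (subst plus_emeasure) (auto simp: Int_Diff_Un)
  have "emeasure M B + emeasure M B = 2 * emeasure M (B \<inter> H) + 2 * emeasure M (B - H)"
    by (subst (1 2) split) (simp add: algebra_simps mult_2)
  also have "\<dots> \<le> emeasure M B + 2 * emeasure M (B - H)"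
    using half by (rule add_right_mono)
  finally show ?thesis
    using fin by (auto simp: ennreal_add_left_cancel_le)
qed

text \<open>
  A ball \<open>B(y, t)\<close> with \<open>(y, t)\<close> in the box lies in \<open>7B\<close>, because \<open>r + 6r = 7r\<close>. At least half of
  it lies outside the level set, where \<open>(SU)\<^sup>2 \<le> 4\<^sup>k\<close>, so the averaging estimate applies with the
  part of \<open>7B\<close> outside the level set.
\<close>
lemma dyadic_box_energy:
  fixes U :: "(real ^ 'n) \<times> real \<Rightarrow> complex"
  assumes [measurable]: "U \<in> borel_measurable borel" "Q \<in> sets borel" and r: "0 < r"
    and Q: "Q \<subseteq> ball c r \<times> {0<..<6 * r}" and sparse: "Q \<inter> dense_balls (level U k) = {}"
  defines "\<omega> \<equiv> unit_ball_vol (real CARD('n))"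
  shows "(\<integral>\<^sup>+ z. ennreal ((cmod (U z))\<^sup>2 / snd z) * indicator Q z \<partial>lborel)
     \<le> ennreal (2 / \<omega> * ((2 powi k)\<^sup>2 * (\<omega> * (7 * r) ^ CARD('n))))"
proof -
  have \<omega>: "\<omega> > 0" by (simp add: \<omega>_def)
  define H where "H = ball c (7 * r) - level U k"
  have [measurable]: "H \<in> sets borel"
    unfolding H_def by measurable
  have "(\<integral>\<^sup>+ z. ennreal ((cmod (U z))\<^sup>2 / snd z) * indicator Q z \<partial>lborel)
     \<le> ennreal (2 / \<omega>) * (\<integral>\<^sup>+ x. cone_energy U x * indicator H x \<partial>lborel)"
    unfolding \<omega>_def
  proof (rule averaging_estimate)
    fix y t assume yt: "(y, t) \<in> Q"
    then have t: "0 < t" "t < 6 * r" "dist c y < r" using Q by auto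
    have "ball y t \<subseteq> ball c (7 * r)"
    proof
      fix x assume "x \<in> ball y t"
      then show "x \<in> ball c (7 * r)"
        using t dist_triangle[of c x y] by auto
    qed
    then have eq: "ball y t \<inter> H = ball y t - level U k"
      by (auto simp: H_def)
    have "2 * emeasure lborel (ball y t \<inter> level U k) \<le> emeasure lborel (ball y t)"
      using yt t sparse by (force simp: dense_balls_def)
    then have "emeasure lborel (ball y t) \<le> 2 * emeasure lborel (ball y t - level U k)"
      using t by (intro emeasure_le_double_Diff) (auto simp: ball_emeasure)
    then show "0 < t \<and> emeasure lborel (ball y t) \<le> 2 * emeasure lborel (ball y t \<inter> H)"
      using t eq by simp
  qed auto
  also have "(\<integral>\<^sup>+ x. cone_energy U x * indicator H x \<partial>lborel)
      \<le> (\<integral>\<^sup>+ x. ennreal ((2 powi k)\<^sup>2) * indicator (ball c (7 * r)) x \<partial>lborel)"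
  proof (intro nn_integral_mono)
    fix x
    have "(square_fun U x)\<^sup>2 \<le> (ennreal (2 powi k))\<^sup>2" if "x \<in> H"
      using that by (intro power_mono) (auto simp: H_def level_def)
    then show "cone_energy U x * indicator H x \<le> ennreal ((2 powi k)\<^sup>2) * indicator (ball c (7 * r)) x"
      by (auto simp: indicator_def square_fun_power2 ennreal_power H_def)
  qed
  also have "\<dots> = ennreal ((2 powi k)\<^sup>2 * (\<omega> * (7 * r) ^ CARD('n)))"
    using r by (subst nn_integral_cmult_indicator) (auto simp: ball_emeasure \<omega>_def simp flip: ennreal_mult)
  also have "ennreal (2 / \<omega>) * \<dots> = ennreal (2 / \<omega> * ((2 powi k)\<^sup>2 * (\<omega> * (7 * r) ^ CARD('n))))"
    using \<omega> r by (subst ennreal_mult) auto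
  finally show ?thesis by (simp add: mult_left_mono)
qed

text \<open>
  A point of the half-space is outside \<open>E\<^sub>k\<close> for large \<open>k\<close>, since the measure of \<open>O\<^sub>k\<close> tends to 0.
  If it is in no \<open>E\<^sub>k\<close> at all, then, as the \<open>O\<^sub>k\<close> exhaust \<open>{SU > 0}\<close> for \<open>k \<rightarrow> -\<infinity>\<close>, at least half of
  its ball lies in \<open>{SU = 0}\<close>. On the set of these points the averaging estimate bounds the energy
  of \<open>U\<close> by \<open>\<integral> (SU)\<^sup>2\<close> over \<open>{SU = 0}\<close>, which is 0, so \<open>U\<close> vanishes almost everywhere there.
  Every other point where \<open>U\<close> does not vanish has a last \<open>k\<close> with \<open>(y, t) \<in> E\<^sub>k\<close>.
\<close>
lemma dyadic_layers_cover_support: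
  fixes U :: "(real ^ 'n) \<times> real \<Rightarrow> complex"
  assumes [measurable]: "U \<in> borel_measurable borel" and fin: "tent_norm U < \<infinity>"
  shows "AE z in lborel. z \<in> upper_half \<longrightarrow> U z \<noteq> 0 \<longrightarrow>
     (\<exists>k. z \<in> dense_balls (level U k) - dense_balls (level U (k + 1)))"
proof -
  obtain u where u: "tent_norm U = ennreal u" "0 \<le> u"
    using fin by (cases "tent_norm U") auto
  have upper: "\<exists>k. z \<notin> dense_balls (level U k)" if z: "z \<in> upper_half" for z
  proof -
    obtain y t where yt: "z = (y, t)" "0 < t"
      using z by (auto simp: upper_half_def)
    define b where "b = unit_ball_vol (real CARD('n)) * t ^ CARD('n)"
    have b: "b > 0" using yt by (simp add: b_def)
    \<comment> \<open>With \<open>b\<close> the measure of the ball, twice the measure of level \<open>m\<close> is at most \<open>4u / 2\<^sup>m < b\<close>.\<close>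
    obtain m where m: "4 * u / b < 2 ^ m"
      using real_arch_pow[of 2 "4 * u / b"] by auto
    have "2 * emeasure lborel (ball y t \<inter> level U (int m)) \<le> 2 * emeasure lborel (level U (int m))"
      by (intro mult_left_mono emeasure_mono) auto
    also have "\<dots> \<le> 2 * ennreal (2 * u / 2 powi (int m))"
      by (intro mult_left_mono level_measure_le u) auto
    also have "\<dots> = ennreal (4 * u / 2 ^ m)"
      using u(2) by (simp flip: ennreal_mult ennreal_numeral)
    also have "\<dots> \<le> ennreal b"
      using m b by (intro ennreal_leI) (simp add: field_simps)
    also have "\<dots> = emeasure lborel (ball y t)"
      using yt by (simp add: ball_emeasure b_def)
    finally have "z \<notin> dense_balls (level U (int m))"
      by (simp add: dense_balls_def yt)
    then show ?thesis ..
  qed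
  define N where "N = upper_half - (\<Union>k. dense_balls (level U k))"
  define H where "H = {x. square_fun U x = 0}"
  have [measurable]: "N \<in> sets borel"
    unfolding N_def by measurable
  have "{x \<in> space borel. square_fun U x = 0} \<in> sets borel"
    by measurable
  then have [measurable]: "H \<in> sets borel"
    by (simp add: H_def)
  \<comment> \<open>Only the levels \<open>k = -m\<close> are needed to exhaust \<open>{SU > 0}\<close>; they increase with \<open>m\<close>.\<close>
  have pos_levels: "(\<Union>m. level U (- int m)) = - H"
  proof -
    have "\<exists>m. ennreal (2 powi (- int m)) < s" if "0 < s" for s
    proof -
      have "(\<lambda>m. ennreal ((1 / 2) ^ m)) \<longlonglongrightarrow> ennreal 0"
        by (intro tendsto_ennrealI LIMSEQ_realpow_zero) auto
      then have "\<forall>\<^sub>F m in sequentially. ennreal ((1 / 2) ^ m) < s"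
        using that by (intro order_tendstoD(2)) auto
      then obtain m where "ennreal ((1 / 2) ^ m) < s"
        by (auto simp: eventually_sequentially)
      then show ?thesis
        by (auto simp: power_int_minus power_one_over inverse_eq_divide intro!: exI[of _ m])
    qed
    then show ?thesis
      by (auto simp: level_def H_def zero_less_iff_neq_zero)
  qed
  have "(\<integral>\<^sup>+ z. ennreal ((cmod (U z))\<^sup>2 / snd z) * indicator N z \<partial>lborel)
     \<le> ennreal (2 / unit_ball_vol (real CARD('n))) * (\<integral>\<^sup>+ x. cone_energy U x * indicator H x \<partial>lborel)"
  proof (rule averaging_estimate)
    fix y t assume yt: "(y, t) \<in> N"
    then have t: "0 < t" by (auto simp: N_def upper_half_def)
    have "(SUP m. emeasure lborel (ball y t \<inter> level U (- int m))) = emeasure lborel (\<Union>m. ball y t \<inter> level U (- int m))"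
    proof (rule SUP_emeasure_incseq)
      show "incseq (\<lambda>m. ball y t \<inter> level U (- int m))"
        using level_antimono[of "- int m" "- int l" U for m l] by (force simp: incseq_def)
    qed auto
    also have "(\<Union>m. ball y t \<inter> level U (- int m)) = ball y t \<inter> - H"
      using pos_levels by auto
    finally have "2 * emeasure lborel (ball y t \<inter> - H) = (SUP m. 2 * emeasure lborel (ball y t \<inter> level U (- int m)))"
      by (simp add: SUP_mult_left_ennreal[symmetric])
    also have "\<dots> \<le> emeasure lborel (ball y t)"
    proof (rule SUP_least)
      fix m
      have "(y, t) \<notin> dense_balls (level U (- int m))"
        using yt by (auto simp: N_def)
      then show "2 * emeasure lborel (ball y t \<inter> level U (- int m)) \<le> emeasure lborel (ball y t)"
        using t by (simp add: dense_balls_def)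
    qed
    finally have "emeasure lborel (ball y t) \<le> 2 * emeasure lborel (ball y t - - H)"
      using t by (intro emeasure_le_double_Diff) (auto simp: ball_emeasure)
    then show "0 < t \<and> emeasure lborel (ball y t) \<le> 2 * emeasure lborel (ball y t \<inter> H)"
      using t by (simp add: Diff_eq)
  qed auto
  also have "(\<integral>\<^sup>+ x. cone_energy U x * indicator H x \<partial>lborel) = (\<integral>\<^sup>+ x. 0 \<partial>(lborel :: (real ^ 'n) measure))"
    by (intro nn_integral_cong) (auto simp: indicator_def H_def simp flip: square_fun_power2)
  finally have "(\<integral>\<^sup>+ z. ennreal ((cmod (U z))\<^sup>2 / snd z) * indicator N z \<partial>lborel) = 0"
    by simp
  then have "AE z in lborel. ennreal ((cmod (U z))\<^sup>2 / snd z) * indicator N z = 0"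
    by (subst (asm) nn_integral_0_iff_AE) auto
  then show ?thesis
  proof eventually_elim
    case (elim z)
    show ?case
    proof (intro impI)
      assume z: "z \<in> upper_half" "U z \<noteq> 0"
      then have "0 < (cmod (U z))\<^sup>2 / snd z"
        by (auto simp: upper_half_def)
      then have "z \<notin> N"
        using elim by (auto simp: ennreal_eq_0_iff)
      then obtain k0 where k0: "z \<in> dense_balls (level U k0)"
        using z by (auto simp: N_def)
      obtain k1 where k1: "z \<notin> dense_balls (level U k1)"
        using upper[OF z(1)] by auto
      show "\<exists>k. z \<in> dense_balls (level U k) - dense_balls (level U (k + 1))"
      proof (rule ccontr)
        assume "\<not> ?thesis"
        then have step: "z \<in> dense_balls (level U (k + 1))" if "z \<in> dense_balls (level U k)" for k
          using that by auto
        have "z \<in> dense_balls (level U k)" if "k0 \<le> k" for k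
          using that by (induction k rule: int_ge_induct) (auto simp: k0 step)
        moreover have "z \<in> dense_balls (level U k)" if "k \<le> k0" for k
          using dense_balls_mono[OF level_antimono[OF that] level_borel[OF assms(1)]] k0 by blast
        ultimately show False
          using k1 by (cases "k0 \<le> k1") auto
      qed
    qed
  qed
qed

section \<open>Normalised atoms\<close>

lemma iterated_integral_eq:
  fixes A :: "(real ^ 'n) \<times> real \<Rightarrow> complex"
  assumes [measurable]: "A \<in> borel_measurable borel"
  shows "(\<integral>\<^sup>+ t \<in> {0<..}. (\<integral>\<^sup>+ y. ennreal ((cmod (A (y, t)))\<^sup>2) \<partial>lebesgue) / ennreal t \<partial>lebesgue)
       = (\<integral>\<^sup>+ z. ennreal ((cmod (A z))\<^sup>2 / snd z) * indicator upper_half z \<partial>lborel)"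
proof -
  define f where "f z = ennreal ((cmod (A z))\<^sup>2 / snd z) * indicator upper_half z" for z
  have [measurable]: "f \<in> borel_measurable borel"
    unfolding f_def [abs_def] by measurable
  have "(\<integral>\<^sup>+ y. f (y, t) \<partial>lborel)
      = (\<integral>\<^sup>+ y. ennreal ((cmod (A (y, t)))\<^sup>2) \<partial>lborel) / ennreal t * indicator {0<..} t" for t
  proof (cases "0 < t")
    case True
    have "(\<integral>\<^sup>+ y. f (y, t) \<partial>lborel) = (\<integral>\<^sup>+ y. ennreal ((cmod (A (y, t)))\<^sup>2) / ennreal t \<partial>lborel)"
      using True by (intro nn_integral_cong) (simp add: f_def upper_half_def divide_ennreal)
    also have "\<dots> = (\<integral>\<^sup>+ y. ennreal ((cmod (A (y, t)))\<^sup>2) \<partial>lborel) / ennreal t"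
      by (intro nn_integral_divide) measurable
    finally show ?thesis using True by simp
  qed (simp add: f_def upper_half_def)
  then have "(\<integral>\<^sup>+ t \<in> {0<..}. (\<integral>\<^sup>+ y. ennreal ((cmod (A (y, t)))\<^sup>2) \<partial>lebesgue) / ennreal t \<partial>lebesgue)
      = (\<integral>\<^sup>+ t. (\<integral>\<^sup>+ y. f (y, t) \<partial>lborel) \<partial>lborel)"
    unfolding nn_integral_completion by simp
  also have "\<dots> = integral\<^sup>N (lborel \<Otimes>\<^sub>M lborel) f"
    by (rule lborel_pair.nn_integral_snd) (simp add: lborel_prod)
  also have "\<dots> = integral\<^sup>N lborel f"
    by (simp add: lborel_prod)
  finally show ?thesis by (simp add: f_def [abs_def])
qed

lemma normalised_atom:
  fixes U :: "(real ^ 'n) \<times> real \<Rightarrow> complex"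
  assumes [measurable]: "U \<in> borel_measurable borel" "Q \<in> sets borel" and Q: "Q \<subseteq> upper_half"
    and E: "(\<integral>\<^sup>+ z. ennreal ((cmod (U z))\<^sup>2 / snd z) * indicator Q z \<partial>lborel) = ennreal e"
    and e: "0 < e"
    and b: "emeasure lborel (ball c r) = ennreal b"  "0 < b"
  defines "A \<equiv> \<lambda>z. (if z \<in> Q then U z else 0) / complex_of_real (sqrt (b * e))"
  shows "emeasure lebesgue (ball c r) *
     (\<integral>\<^sup>+ t \<in> {0<..}. (\<integral>\<^sup>+ y. ennreal ((cmod (A (y, t)))\<^sup>2) \<partial>lebesgue) / ennreal t \<partial>lebesgue) = 1"
proof -
  have [measurable]: "A \<in> borel_measurable borel"
    unfolding A_def by measurable
  have be: "0 < b * e" using b e by simp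
  have "(\<integral>\<^sup>+ z. ennreal ((cmod (A z))\<^sup>2 / snd z) * indicator upper_half z \<partial>lborel)
      = (\<integral>\<^sup>+ z. ennreal (1 / (b * e)) * (ennreal ((cmod (U z))\<^sup>2 / snd z) * indicator Q z) \<partial>lborel)"
  proof (intro nn_integral_cong)
    fix z :: "(real ^ 'n) \<times> real"
    show "ennreal ((cmod (A z))\<^sup>2 / snd z) * indicator upper_half z
       = ennreal (1 / (b * e)) * (ennreal ((cmod (U z))\<^sup>2 / snd z) * indicator Q z)"
    proof (cases "z \<in> Q")
      case True
      then have "z \<in> upper_half" "0 < snd z" using Q by (auto simp: upper_half_def)
      then show ?thesis
        using True be by (simp add: A_def norm_divide power_divide flip: ennreal_mult)
    qed (simp add: A_def)
  qed
  also have "\<dots> = ennreal (1 / (b * e)) * ennreal e"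
    unfolding E[symmetric] by (intro nn_integral_cmult) measurable
  finally show ?thesis
    using b e by (simp add: iterated_integral_eq flip: ennreal_mult)
qed

section \<open>Decomposition into boxes over Whitney balls\<close>

text \<open>
  The balls are restricted to those carried by points of the tent. Each of them lies in \<open>\<Omega>\<close>, so a
  covering of the hull yields atoms that live over \<open>\<Omega>\<close>.
\<close>
definition dense_hull :: "(real ^ 'n) set \<Rightarrow> (real ^ 'n) set \<Rightarrow> (real ^ 'n) set" where
  "dense_hull \<Omega> H = (\<Union>(y, t)\<in>dense_balls H \<inter> tent \<Omega>. ball y t)"

lemma ball_subset_of_tent:
  assumes "(y, t) \<in> tent \<Omega>"
  shows "ball y t \<subseteq> \<Omega>"
proof
  fix x assume x: "x \<in> ball y t"
  show "x \<in> \<Omega>"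
  proof (rule ccontr)
    assume "x \<notin> \<Omega>"
    then have "infdist y (- \<Omega>) \<le> dist y x"
      by (intro infdist_le) auto
    then show False
      using assms x \<open>x \<notin> \<Omega>\<close> by (auto simp: tent_def)
  qed
qed

lemma open_dense_hull: "open (dense_hull \<Omega> H)"
  unfolding dense_hull_def by (intro open_UN) auto

lemma dense_hull_subset: "dense_hull \<Omega> H \<subseteq> \<Omega>"
  unfolding dense_hull_def using ball_subset_of_tent by blast

lemma dense_hull_measure_le:
  fixes H :: "(real ^ 'n) set"
  assumes "H \<in> sets borel" "emeasure lborel H < \<infinity>"
  shows "emeasure lborel (dense_hull \<Omega> H) \<le> ennreal (2 * 5 ^ CARD('n)) * emeasure lborel H"
  unfolding dense_hull_def using assms by (intro dense_balls_union_measure) auto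

text \<open>
  Here \<open>\<rho>\<close> and \<open>C\<close> stand for the Whitney radii and centres of the hulls. The factor \<open>25\<^sup>n = 5\<^sup>n 5\<^sup>n\<close>
  collects the two applications of the Vitali lemma, and the factor 4 the density one half and the
  dyadic sum.
\<close>
lemma sum_dyadic_ball_measures_le:
  fixes U :: "(real ^ 'n) \<times> real \<Rightarrow> complex" and C :: "int \<Rightarrow> (real ^ 'n) set"
  assumes [measurable]: "U \<in> borel_measurable borel" and fin: "tent_norm U < \<infinity>"
    and C: "\<And>k F. finite F \<Longrightarrow> F \<subseteq> C k \<Longrightarrow>
       (\<Sum>c\<in>F. emeasure lborel (ball c (\<rho> k c))) \<le> ennreal (5 ^ CARD('n)) * emeasure lborel (dense_hull \<Omega> (level U k))"
    and G: "finite G" "G \<subseteq> Sigma UNIV C"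
  shows "(\<Sum>(k, c)\<in>G. ennreal (2 powi k) * emeasure lborel (ball c (\<rho> k c)))
     \<le> ennreal (4 * 25 ^ CARD('n)) * tent_norm U"
proof -
  obtain u where u: "tent_norm U = ennreal u" "0 \<le> u"
    using fin by (cases "tent_norm U") auto
  have hull: "emeasure lborel (dense_hull \<Omega> (level U k)) \<le> ennreal (2 * 5 ^ CARD('n)) * emeasure lborel (level U k)" for k
    using level_measure_le[OF assms(1) u, of k]
    by (intro dense_hull_measure_le) (auto intro: le_less_trans)
  have slice: "finite {c. (k, c) \<in> G}" for k
    by (rule finite_subset[of _ "snd ` G"]) (use G(1) in \<open>auto intro: rev_image_eqI\<close>)
  have "G = Sigma (fst ` G) (\<lambda>k. {c. (k, c) \<in> G})"
    by force
  then have "(\<Sum>(k, c)\<in>G. ennreal (2 powi k) * emeasure lborel (ball c (\<rho> k c)))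
      = (\<Sum>(k, c)\<in>Sigma (fst ` G) (\<lambda>k. {c. (k, c) \<in> G}). ennreal (2 powi k) * emeasure lborel (ball c (\<rho> k c)))"
    by simp
  also have "\<dots> = (\<Sum>k\<in>fst ` G. \<Sum>c\<in>{c. (k, c) \<in> G}. ennreal (2 powi k) * emeasure lborel (ball c (\<rho> k c)))"
    using G(1) by (intro sum.Sigma[symmetric] ballI slice) auto
  also have "\<dots> \<le> (\<Sum>k\<in>fst ` G. ennreal (2 * 25 ^ CARD('n)) * (ennreal (2 powi k) * emeasure lborel (level U k)))"
  proof (rule sum_mono)
    fix k
    have "(\<Sum>c\<in>{c. (k, c) \<in> G}. emeasure lborel (ball c (\<rho> k c)))
        \<le> ennreal (5 ^ CARD('n)) * emeasure lborel (dense_hull \<Omega> (level U k))"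
    proof (rule C)
      show "finite {c. (k, c) \<in> G}"
        by (rule slice)
      show "{c. (k, c) \<in> G} \<subseteq> C k"
        using G(2) by auto
    qed
    also have "\<dots> \<le> ennreal (5 ^ CARD('n)) * (ennreal (2 * 5 ^ CARD('n)) * emeasure lborel (level U k))"
      by (intro mult_left_mono hull) auto
    also have "\<dots> = ennreal (5 ^ CARD('n) * (2 * 5 ^ CARD('n))) * emeasure lborel (level U k)"
      by (simp add: ennreal_mult mult.assoc)
    also have "(5::real) ^ CARD('n) * (2 * 5 ^ CARD('n)) = 2 * 25 ^ CARD('n)"
      by (simp flip: power_mult_distrib)
    finally have "ennreal (2 powi k) * (\<Sum>c\<in>{c. (k, c) \<in> G}. emeasure lborel (ball c (\<rho> k c)))
       \<le> ennreal (2 powi k) * (ennreal (2 * 25 ^ CARD('n)) * emeasure lborel (level U k))"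
      by (intro mult_left_mono) auto
    then show "(\<Sum>c\<in>{c. (k, c) \<in> G}. ennreal (2 powi k) * emeasure lborel (ball c (\<rho> k c)))
       \<le> ennreal (2 * 25 ^ CARD('n)) * (ennreal (2 powi k) * emeasure lborel (level U k))"
      by (simp add: sum_distrib_left mult_ac)
  qed
  also have "\<dots> = ennreal (2 * 25 ^ CARD('n)) * (\<Sum>k\<in>fst ` G. ennreal (2 powi k) * emeasure lborel (level U k))"
    by (rule sum_distrib_left[symmetric])
  also have "\<dots> \<le> ennreal (2 * 25 ^ CARD('n)) * (2 * tent_norm U)"
    using G(1) by (intro mult_left_mono sum_level_measures_le) auto
  also have "\<dots> = ennreal (4 * 25 ^ CARD('n)) * tent_norm U"
  proof -
    have "ennreal (4 * 25 ^ CARD('n)) = ennreal (2 * 25 ^ CARD('n)) * 2"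
      by (simp flip: ennreal_mult ennreal_numeral)
    then show ?thesis by (simp add: mult.assoc)
  qed
  finally show ?thesis .
qed

text \<open>
  The square of this number is \<open>4 \<cdot> 2 \<cdot> 7\<^sup>n / \<omega>\<^sub>n\<close>: the 4 is the step from \<open>2\<^sup>k\<close> to \<open>2\<^sup>k\<^sup>+\<^sup>1\<close>, the
  \<open>2 / \<omega>\<^sub>n\<close> comes from the averaging estimate, and \<open>7\<^sup>n\<close> from the enlarged ball \<open>7B\<close>.
\<close>
definition atom_constant :: "nat \<Rightarrow> real" where
  "atom_constant n = sqrt (8 * 7 ^ n / unit_ball_vol (real n))"

lemma coefficient_bound:
  assumes \<omega>: "\<omega> = unit_ball_vol (real n)" and r: "0 < r"
    and e: "e \<le> 2 / \<omega> * ((2 powi (k + 1))\<^sup>2 * (\<omega> * (7 * r) ^ n))"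
  shows "sqrt (\<omega> * r ^ n * e) \<le> atom_constant n * (2 powi k * (\<omega> * r ^ n))"
proof (rule real_le_lsqrt)
  have w: "\<omega> > 0" by (simp add: \<omega>)
  show "0 \<le> atom_constant n * (2 powi k * (\<omega> * r ^ n))"
    using w r by (simp add: atom_constant_def \<omega>)
  have "\<omega> * r ^ n * e \<le> \<omega> * r ^ n * (2 / \<omega> * ((2 powi (k + 1))\<^sup>2 * (\<omega> * (7 * r) ^ n)))"
    using w r e by (intro mult_left_mono) auto
  also have "\<dots> = 8 * 7 ^ n / \<omega> * (2 powi k * (\<omega> * r ^ n))\<^sup>2"
    using w by (simp add: power_int_add power_mult_distrib power2_eq_square field_simps)
  also have "\<dots> = (atom_constant n * (2 powi k * (\<omega> * r ^ n)))\<^sup>2"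
    using w by (simp add: atom_constant_def \<omega> power_mult_distrib)
  finally show "\<omega> * r ^ n * e \<le> (atom_constant n * (2 powi k * (\<omega> * r ^ n)))\<^sup>2" .
qed

text \<open>
  Piece \<open>j\<close> belongs to the layer \<open>E\<^sub>k - E\<^sub>k\<^sub>+\<^sub>1\<close> with \<open>k = \<kappa> j\<close> and to one Whitney ball of the hull \<open>W\<^sub>k\<close>.
  If \<open>(y, t)\<close> lies in \<open>E\<^sub>k\<close> and in the tent, then \<open>B(y, t)\<close> is contained in \<open>W\<^sub>k\<close> by construction, so
  its Whitney boxes contain \<open>(y, t)\<close>. All pairs of a level and a centre are numbered by natural
  numbers, and the boxes are made disjoint in this order.
\<close>
lemma exists_disjoint_layers:
  fixes U :: "(real ^ 'n) \<times> real \<Rightarrow> complex"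
  assumes U [measurable]: "U \<in> borel_measurable borel" and fin: "tent_norm U < \<infinity>"
    and zero: "\<And>z. z \<notin> tent \<Omega> \<Longrightarrow> U z = 0"
  obtains K :: "nat set" and \<kappa> :: "nat \<Rightarrow> int" and c :: "nat \<Rightarrow> real ^ 'n" and r :: "nat \<Rightarrow> real"
    and Q :: "nat \<Rightarrow> ((real ^ 'n) \<times> real) set"
  where "disjoint_family Q" "\<And>j. Q j \<in> sets borel"
    "\<And>j. j \<in> K \<Longrightarrow> 0 < r j \<and> ball (c j) (5 * r j) \<subseteq> \<Omega> \<and> Q j \<subseteq> ball (c j) (r j) \<times> {0<..<6 * r j}"
    "\<And>j. j \<in> K \<Longrightarrow> Q j \<inter> dense_balls (level U (\<kappa> j + 1)) = {}"
    "AE z in lborel. z \<in> upper_half \<longrightarrow> U z \<noteq> 0 \<longrightarrow> z \<in> (\<Union>j\<in>K. Q j)"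
    "\<And>F. finite F \<Longrightarrow> F \<subseteq> K \<Longrightarrow>
       (\<Sum>j\<in>F. ennreal (2 powi \<kappa> j) * emeasure lborel (ball (c j) (r j))) \<le> ennreal (4 * 25 ^ CARD('n)) * tent_norm U"
proof -
  obtain u where u: "tent_norm U = ennreal u" "0 \<le> u"
    using fin by (cases "tent_norm U") auto
  define W where "W k = dense_hull \<Omega> (level U k)" for k
  define \<rho> where "\<rho> k x = infdist x (- W k) / 5" for k x
  have fin_level: "emeasure lborel (level U k) < \<infinity>" for k
    using level_measure_le[OF U u, of k] by (auto intro: le_less_trans)
  have fin_W: "emeasure lborel (W k) < \<infinity>" for k
  proof -
    have "emeasure lborel (W k) \<le> ennreal (2 * 5 ^ CARD('n)) * emeasure lborel (level U k)"
      unfolding W_def using fin_level by (intro dense_hull_measure_le) auto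
    also have "\<dots> < \<infinity>"
      using fin_level by (simp add: ennreal_mult_less_top)
    finally show ?thesis .
  qed
  define whitney where "whitney k C \<longleftrightarrow> countable C \<and> (\<forall>x\<in>C. 0 < \<rho> k x \<and> ball x (5 * \<rho> k x) \<subseteq> W k) \<and>
     (\<forall>y t. ball y t \<subseteq> W k \<longrightarrow> y \<in> W k \<longrightarrow> (\<exists>x\<in>C. y \<in> ball x (\<rho> k x) \<and> t < 6 * \<rho> k x)) \<and>
     (\<forall>F. finite F \<longrightarrow> F \<subseteq> C \<longrightarrow>
       (\<Sum>x\<in>F. emeasure lborel (ball x (\<rho> k x))) \<le> ennreal (5 ^ CARD('n)) * emeasure lborel (W k))" for k C
  have "\<exists>C. whitney k C" for k
  proof (rule whitney_covering[OF _ fin_W[of k]])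
    show "open (W k)" by (simp add: W_def open_dense_hull)
  next
    fix C
    assume "countable C"
      and "\<And>c. c \<in> C \<Longrightarrow> 0 < infdist c (- W k) \<and> ball c (infdist c (- W k)) \<subseteq> W k"
      and "\<And>y t. ball y t \<subseteq> W k \<Longrightarrow> y \<in> W k \<Longrightarrow>
        \<exists>c\<in>C. y \<in> ball c (infdist c (- W k) / 5) \<and> t < 6 * (infdist c (- W k) / 5)"
      and "\<And>F. finite F \<Longrightarrow> F \<subseteq> C \<Longrightarrow>
        (\<Sum>c\<in>F. emeasure lborel (ball c (infdist c (- W k) / 5))) \<le> ennreal (5 ^ CARD('n)) * emeasure lborel (W k)"
    then show ?thesis
      unfolding whitney_def \<rho>_def by (intro exI[of _ C]) auto
  qed
  then obtain C where "\<And>k. whitney k (C k)"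
    by metis
  then have C: "\<And>k. countable (C k)"
    "\<And>k x. x \<in> C k \<Longrightarrow> 0 < \<rho> k x \<and> ball x (5 * \<rho> k x) \<subseteq> W k"
    "\<And>k y t. ball y t \<subseteq> W k \<Longrightarrow> y \<in> W k \<Longrightarrow> \<exists>x\<in>C k. y \<in> ball x (\<rho> k x) \<and> t < 6 * \<rho> k x"
    "\<And>k F. finite F \<Longrightarrow> F \<subseteq> C k \<Longrightarrow>
       (\<Sum>x\<in>F. emeasure lborel (ball x (\<rho> k x))) \<le> ennreal (5 ^ CARD('n)) * emeasure lborel (W k)"
    unfolding whitney_def by blast+
  define I where "I = Sigma UNIV C"
  have "countable I"
    unfolding I_def using C(1) by auto
  then obtain \<iota> :: "int \<times> (real ^ 'n) \<Rightarrow> nat" where \<iota>: "inj_on \<iota> I"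
    by (auto simp: countable_def)
  define K where "K = \<iota> ` I"
  define h where "h = inv_into I \<iota>"
  have h: "h j \<in> I" "\<iota> (h j) = j" if "j \<in> K" for j
    using that by (auto simp: h_def K_def inv_into_into f_inv_into_f)
  have h_\<iota>: "h (\<iota> i) = i" if "i \<in> I" for i
    using that \<iota> by (simp add: h_def)
  define \<kappa> where "\<kappa> j = fst (h j)" for j
  define c where "c j = snd (h j)" for j
  define r where "r j = \<rho> (\<kappa> j) (c j)" for j
  have hC: "c j \<in> C (\<kappa> j)" if "j \<in> K" for j
    using h(1)[OF that] by (auto simp: I_def c_def \<kappa>_def)
  \<comment> \<open>Both the hull of level \<open>\<kappa> j\<close> and the layer enter: the box comes from a Whitney ball of the
  hull, and removing the next level leaves the part with controlled energy.\<close>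
  define P where "P j = (ball (c j) (r j) \<times> {0<..<6 * r j}) \<inter>
      (dense_balls (level U (\<kappa> j)) - dense_balls (level U (\<kappa> j + 1)))" for j
  define Q where "Q = disjointed (\<lambda>j. if j \<in> K then P j else {})"
  have "ball (c j) (r j) \<times> {0<..<6 * r j} \<in> sets borel" for j
    by (intro borel_open open_Times) auto
  then have P_borel: "P j \<in> sets borel" for j
    unfolding P_def by (intro sets.Int sets.Diff dense_balls_borel level_borel U)
  have Q_sub: "Q j \<subseteq> P j" if "j \<in> K" for j
    unfolding Q_def using disjointed_subset[of "\<lambda>j. if j \<in> K then P j else {}" j] that by simp
  have Q_empty: "Q j = {}" if "j \<notin> K" for j
    unfolding Q_def using disjointed_subset[of "\<lambda>j. if j \<in> K then P j else {}" j] that by simp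
  have "(\<Union>j\<in>K. Q j) = (\<Union>j. Q j)"
    using Q_empty by auto
  also have "\<dots> = (\<Union>j\<in>K. P j)"
    unfolding Q_def UN_disjointed_eq by auto
  finally have Q_union: "(\<Union>j\<in>K. Q j) = (\<Union>j\<in>K. P j)" .
  show thesis
  proof (rule that)
    show "disjoint_family Q"
      unfolding Q_def by (rule disjoint_family_disjointed)
    show "Q j \<in> sets borel" for j
      using sets.range_disjointed_sets[of "\<lambda>j. if j \<in> K then P j else {}" borel] P_borel
      by (auto simp: Q_def)
    show "0 < r j \<and> ball (c j) (5 * r j) \<subseteq> \<Omega> \<and> Q j \<subseteq> ball (c j) (r j) \<times> {0<..<6 * r j}"
      if j: "j \<in> K" for j
      using C(2)[OF hC[OF j]] Q_sub[OF j] dense_hull_subset[of \<Omega> "level U (\<kappa> j)"]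
      unfolding r_def P_def W_def by blast
    show "Q j \<inter> dense_balls (level U (\<kappa> j + 1)) = {}" if "j \<in> K" for j
      using Q_sub[OF that] by (auto simp: P_def)
    show "AE z in lborel. z \<in> upper_half \<longrightarrow> U z \<noteq> 0 \<longrightarrow> z \<in> (\<Union>j\<in>K. Q j)"
      using dyadic_layers_cover_support[OF U fin]
    proof eventually_elim
      case (elim z)
      show ?case
      proof (intro impI)
        assume z: "z \<in> upper_half" "U z \<noteq> 0"
        obtain y t where yt: "z = (y, t)" by (cases z)
        obtain k where k: "z \<in> dense_balls (level U k)" "z \<notin> dense_balls (level U (k + 1))"
          using elim z by auto
        have "(y, t) \<in> dense_balls (level U k) \<inter> tent \<Omega>"
          using k(1) zero[of z] z(2) yt by auto
        then have ball_W: "ball y t \<subseteq> W k"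
          unfolding W_def dense_hull_def by auto
        have t: "0 < t"
          using z(1) yt by (auto simp: upper_half_def)
        then have "y \<in> W k"
          using ball_W by auto
        with ball_W obtain x where x: "x \<in> C k" "y \<in> ball x (\<rho> k x)" "t < 6 * \<rho> k x"
          using C(3)[of y t k] by auto
        then have i: "(k, x) \<in> I"
          by (simp add: I_def)
        then have "z \<in> P (\<iota> (k, x))"
          using x t k by (simp add: P_def r_def c_def \<kappa>_def h_\<iota> yt)
        then show "z \<in> (\<Union>j\<in>K. Q j)"
          unfolding Q_union using i by (auto simp: K_def)
      qed
    qed
    show "(\<Sum>j\<in>F. ennreal (2 powi \<kappa> j) * emeasure lborel (ball (c j) (r j))) \<le> ennreal (4 * 25 ^ CARD('n)) * tent_norm U"
      if F: "finite F" "F \<subseteq> K" for F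
    proof -
      have inj: "inj_on h F"
        using F(2) h(2) by (metis inj_onI subsetD)
      have "(\<Sum>j\<in>F. ennreal (2 powi \<kappa> j) * emeasure lborel (ball (c j) (r j)))
          = (\<Sum>(k, x)\<in>h ` F. ennreal (2 powi k) * emeasure lborel (ball x (\<rho> k x)))"
        by (simp add: sum.reindex[OF inj] case_prod_beta' r_def c_def \<kappa>_def)
      also have "\<dots> \<le> ennreal (4 * 25 ^ CARD('n)) * tent_norm U"
      proof (rule sum_dyadic_ball_measures_le[OF U fin])
        show "h ` F \<subseteq> Sigma UNIV C"
          using F(2) h(1) unfolding I_def by blast
      qed (use F C(4) in \<open>auto simp: W_def\<close>)
      finally show ?thesis .
    qed
  qed
qed

definition decomposition_constant :: "nat \<Rightarrow> real" where
  "decomposition_constant n = atom_constant n * (4 * 25 ^ n)"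

text \<open>
  The conclusion of the theorem as a predicate, so that it can be transferred between functions that
  agree almost everywhere.
\<close>
definition atomic_decomposition ::
    "real \<Rightarrow> (real ^ 'n) set \<Rightarrow> ((real ^ 'n) \<times> real \<Rightarrow> complex) \<Rightarrow> bool" where
  "atomic_decomposition C \<Omega> U \<longleftrightarrow>
    (\<exists>(K :: nat set) (lam :: nat \<Rightarrow> complex) (c :: nat \<Rightarrow> real ^ 'n) (r :: nat \<Rightarrow> real)
       (A :: nat \<Rightarrow> (real ^ 'n) \<times> real \<Rightarrow> complex).
       has_tent_sum (\<lambda>k z. lam k * A k z) U K \<and>
       (\<lambda>k. cmod (lam k)) summable_on K \<and>
       (\<Sum>\<^sub>\<infinity>k\<in>K. cmod (lam k)) \<le> C * enn2real (tent_norm U) \<and>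
       (\<forall>k\<in>K.
          0 < r k \<and>
          halfspace_measurable (A k) \<and>
          supp_subset (A k) (ball (c k) (r k) \<times> {0<..<6 * r k}) \<and>
          ball (c k) (5 * r k) \<subseteq> \<Omega> \<and>
          emeasure lebesgue (ball (c k) (r k)) *
            (\<integral>\<^sup>+ t \<in> {0<..}.
               (\<integral>\<^sup>+ y. ennreal ((cmod (A k (y, t)))\<^sup>2) \<partial>lebesgue) / ennreal t \<partial>lebesgue) = 1))"

text \<open>
  A piece on which \<open>U\<close> has zero energy cannot be normalised. Such a piece vanishes almost everywhere,
  and discarding it does not affect the covering of the support.
\<close>
lemma atomic_decomposition_borel:
  fixes U :: "(real ^ 'n) \<times> real \<Rightarrow> complex"
  assumes U [measurable]: "U \<in> borel_measurable borel" and fin: "tent_norm U < \<infinity>"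
    and zero: "\<And>z. z \<notin> tent \<Omega> \<Longrightarrow> U z = 0"
  shows "atomic_decomposition (decomposition_constant CARD('n)) \<Omega> U"
proof (rule exists_disjoint_layers[OF assms])
  fix K0 :: "nat set" and \<kappa> :: "nat \<Rightarrow> int" and c :: "nat \<Rightarrow> real ^ 'n" and r :: "nat \<Rightarrow> real"
    and Q :: "nat \<Rightarrow> ((real ^ 'n) \<times> real) set"
  assume disj: "disjoint_family Q" and Q [measurable]: "\<And>j. Q j \<in> sets borel"
    and box: "\<And>j. j \<in> K0 \<Longrightarrow> 0 < r j \<and> ball (c j) (5 * r j) \<subseteq> \<Omega> \<and> Q j \<subseteq> ball (c j) (r j) \<times> {0<..<6 * r j}"
    and sparse: "\<And>j. j \<in> K0 \<Longrightarrow> Q j \<inter> dense_balls (level U (\<kappa> j + 1)) = {}"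
    and cover: "AE z in lborel. z \<in> upper_half \<longrightarrow> U z \<noteq> 0 \<longrightarrow> z \<in> (\<Union>j\<in>K0. Q j)"
    and sums: "\<And>F. finite F \<Longrightarrow> F \<subseteq> K0 \<Longrightarrow>
       (\<Sum>j\<in>F. ennreal (2 powi \<kappa> j) * emeasure lborel (ball (c j) (r j))) \<le> ennreal (4 * 25 ^ CARD('n)) * tent_norm U"
  define \<omega> where "\<omega> = unit_ball_vol (real CARD('n))"
  have \<omega>: "0 < \<omega>" by (simp add: \<omega>_def)
  define E where "E j = (\<integral>\<^sup>+ z. ennreal ((cmod (U z))\<^sup>2 / snd z) * indicator (Q j) z \<partial>lborel)" for j
  define e where "e j = enn2real (E j)" for j
  define b where "b j = \<omega> * r j ^ CARD('n)" for j
  define l where "l j = sqrt (b j * e j)" for j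
  define K where "K = {j \<in> K0. E j \<noteq> 0}"
  define A where "A j z = (if z \<in> Q j then U z else 0) / complex_of_real (l j)" for j z
  have E_le: "E j \<le> ennreal (2 / \<omega> * ((2 powi (\<kappa> j + 1))\<^sup>2 * (\<omega> * (7 * r j) ^ CARD('n))))" if "j \<in> K0" for j
    unfolding E_def \<omega>_def using box[OF that] sparse[OF that] by (intro dyadic_box_energy[where c = "c j"]) auto
  have E_e: "E j = ennreal (e j)" if "j \<in> K0" for j
  proof -
    have "E j < top"
      by (rule le_less_trans[OF E_le[OF that]]) simp
    then show ?thesis by (simp add: e_def)
  qed
  have b: "0 < b j" "emeasure lborel (ball (c j) (r j)) = ennreal (b j)" if "j \<in> K0" for j
    using box[OF that] \<omega> by (auto simp: b_def ball_emeasure \<omega>_def)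
  have e_pos: "0 < e j" if "j \<in> K" for j
  proof -
    have "j \<in> K0" "E j \<noteq> 0" using that by (auto simp: K_def)
    then show ?thesis
      using E_e[of j] by (cases "e j \<le> 0") (auto simp: ennreal_neg)
  qed
  have K_sub: "K \<subseteq> K0" by (auto simp: K_def)
  have l_pos: "0 < l j" if "j \<in> K" for j
    using e_pos[OF that] b(1)[of j] K_sub that by (auto simp: l_def)
  have l_le: "l j \<le> atom_constant CARD('n) * (2 powi \<kappa> j * b j)" if "j \<in> K" for j
  proof -
    have j: "j \<in> K0" using that K_sub by auto
    have "e j \<le> 2 / \<omega> * ((2 powi (\<kappa> j + 1))\<^sup>2 * (\<omega> * (7 * r j) ^ CARD('n)))"
      using E_le[OF j] E_e[OF j] \<omega> box[OF j] by simp
    then show ?thesis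
      unfolding l_def b_def using box[OF j] by (intro coefficient_bound) (auto simp: \<omega>_def)
  qed
  have sum_le: "(\<Sum>j\<in>F. l j) \<le> decomposition_constant CARD('n) * enn2real (tent_norm U)"
    if F: "finite F" "F \<subseteq> K" for F
  proof -
    have ac: "0 \<le> atom_constant CARD('n)" by (simp add: atom_constant_def)
    have pos: "0 \<le> 2 powi \<kappa> j * b j" if "j \<in> F" for j
      using b(1)[of j] K_sub F that by (auto intro!: less_imp_le mult_pos_pos)
    have "ennreal (\<Sum>j\<in>F. 2 powi \<kappa> j * b j) = (\<Sum>j\<in>F. ennreal (2 powi \<kappa> j * b j))"
      by (rule sum_ennreal[symmetric]) (rule pos)
    also have "\<dots> = (\<Sum>j\<in>F. ennreal (2 powi \<kappa> j) * emeasure lborel (ball (c j) (r j)))"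
    proof (rule sum.cong)
      fix j assume "j \<in> F"
      then have "j \<in> K0" using F K_sub by auto
      then show "ennreal (2 powi \<kappa> j * b j) = ennreal (2 powi \<kappa> j) * emeasure lborel (ball (c j) (r j))"
        using b[of j] by (simp add: ennreal_mult)
    qed simp
    also have "\<dots> \<le> ennreal (4 * 25 ^ CARD('n)) * tent_norm U"
      using F K_sub by (intro sums) auto
    also have "\<dots> = ennreal (4 * 25 ^ CARD('n) * enn2real (tent_norm U))"
      using fin by (simp add: ennreal_mult)
    finally have "(\<Sum>j\<in>F. 2 powi \<kappa> j * b j) \<le> 4 * 25 ^ CARD('n) * enn2real (tent_norm U)"
      by (subst (asm) ennreal_le_iff) auto
    then have "atom_constant CARD('n) * (\<Sum>j\<in>F. 2 powi \<kappa> j * b j)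
        \<le> atom_constant CARD('n) * (4 * 25 ^ CARD('n) * enn2real (tent_norm U))"
      using ac by (rule mult_left_mono)
    moreover have "(\<Sum>j\<in>F. l j) \<le> atom_constant CARD('n) * (\<Sum>j\<in>F. 2 powi \<kappa> j * b j)"
      unfolding sum_distrib_left using F by (intro sum_mono l_le) auto
    ultimately show ?thesis
      by (simp add: decomposition_constant_def mult.assoc)
  qed
  have norm_l: "cmod (complex_of_real (l j)) = l j" if "j \<in> K" for j
    using l_pos[OF that] by simp
  have summable: "(\<lambda>j. cmod (complex_of_real (l j))) summable_on K"
  proof (rule nonneg_bdd_above_summable_on)
    show "bdd_above (sum (\<lambda>j. cmod (complex_of_real (l j))) ` {F. F \<subseteq> K \<and> finite F})"
    proof (rule bdd_aboveI2)
      fix F assume "F \<in> {F. F \<subseteq> K \<and> finite F}"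
      then have F: "F \<subseteq> K" "finite F" by auto
      then have "(\<Sum>j\<in>F. cmod (complex_of_real (l j))) = (\<Sum>j\<in>F. l j)"
        using norm_l by (intro sum.cong) auto
      then show "(\<Sum>j\<in>F. cmod (complex_of_real (l j))) \<le> decomposition_constant CARD('n) * enn2real (tent_norm U)"
        using sum_le[OF F(2,1)] by simp
    qed
  qed auto
  have bound: "(\<Sum>\<^sub>\<infinity>j\<in>K. cmod (complex_of_real (l j))) \<le> decomposition_constant CARD('n) * enn2real (tent_norm U)"
  proof (rule infsum_le_finite_sums[OF summable])
    fix F assume F: "finite F" "F \<subseteq> K"
    then have "(\<Sum>j\<in>F. cmod (complex_of_real (l j))) = (\<Sum>j\<in>F. l j)"
      using norm_l by (intro sum.cong) auto
    then show "(\<Sum>j\<in>F. cmod (complex_of_real (l j))) \<le> decomposition_constant CARD('n) * enn2real (tent_norm U)"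
      using sum_le[OF F] by simp
  qed
  have null: "AE z in lborel. z \<in> upper_half \<longrightarrow> z \<in> Q j \<longrightarrow> U z = 0" if "E j = 0" for j
  proof -
    have "AE z in lborel. ennreal ((cmod (U z))\<^sup>2 / snd z) * indicator (Q j) z = 0"
      using that unfolding E_def by (subst (asm) nn_integral_0_iff_AE) auto
    then show ?thesis
    proof eventually_elim
      case (elim z)
      show ?case
      proof (intro impI)
        assume z: "z \<in> upper_half" "z \<in> Q j"
        then have "ennreal ((cmod (U z))\<^sup>2 / snd z) = 0"
          using elim by simp
        moreover have "0 < snd z" using z by (auto simp: upper_half_def)
        ultimately show "U z = 0"
          by (auto simp: ennreal_eq_0_iff divide_le_0_iff)
      qed
    qed
  qed
  have "AE z in lborel. \<forall>j. E j = 0 \<longrightarrow> z \<in> upper_half \<longrightarrow> z \<in> Q j \<longrightarrow> U z = 0"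
    using null by (auto simp: AE_all_countable)
  then have cover': "AE z in lborel. z \<in> upper_half \<longrightarrow> U z \<noteq> 0 \<longrightarrow> z \<in> (\<Union>j\<in>K. Q j)"
    using cover by eventually_elim (auto simp: K_def)
  have "has_tent_sum (\<lambda>j z. if z \<in> Q j then U z else 0) U K"
    by (rule has_tent_sum_partition[OF U fin Q disj cover'])
  moreover have "has_tent_sum (\<lambda>j z. if z \<in> Q j then U z else 0) U K
      \<longleftrightarrow> has_tent_sum (\<lambda>j z. complex_of_real (l j) * A j z) U K"
  proof (rule has_tent_sum_cong)
    show "(if z \<in> Q j then U z else 0) = complex_of_real (l j) * A j z" if "j \<in> K" for j z
      using l_pos[OF that] by (simp add: A_def)
  qed
  ultimately have tsum: "has_tent_sum (\<lambda>j z. complex_of_real (l j) * A j z) U K"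
    by simp
  show ?thesis
    unfolding atomic_decomposition_def
  proof (intro exI conjI ballI)
    fix j assume j: "j \<in> K"
    then have j0: "j \<in> K0" using K_sub by auto
    show "0 < r j" "ball (c j) (5 * r j) \<subseteq> \<Omega>"
      using box[OF j0] by auto
    have A_borel: "A j \<in> borel_measurable borel"
      unfolding A_def [abs_def] by measurable
    then show "halfspace_measurable (A j)"
      by (rule halfspace_measurable_borel)
    have "A j z = 0" if "z \<notin> ball (c j) (r j) \<times> {0<..<6 * r j}" for z
      using box[OF j0] that by (auto simp: A_def)
    then show "supp_subset (A j) (ball (c j) (r j) \<times> {0<..<6 * r j})"
      by (simp add: supp_subset_def)
    have "Q j \<subseteq> upper_half"
      using box[OF j0] by (auto simp: upper_half_def)
    then show "emeasure lebesgue (ball (c j) (r j)) *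
        (\<integral>\<^sup>+ t \<in> {0<..}. (\<integral>\<^sup>+ y. ennreal ((cmod (A j (y, t)))\<^sup>2) \<partial>lebesgue) / ennreal t \<partial>lebesgue) = 1"
      unfolding A_def l_def
      using e_pos[OF j] b[OF j0] box[OF j0] E_e[OF j0]
      by (intro normalised_atom) (auto simp: E_def)
  qed (fact tsum summable bound)+
qed

text \<open>
  A Borel representative makes the iterated integrals in the statement accessible to Tonelli's theorem
  for Borel functions, and setting it to 0 off the tent turns the almost-everywhere support
  condition into a pointwise one.
\<close>
lemma borel_representative:
  fixes U :: "(real ^ 'n) \<times> real \<Rightarrow> complex"
  assumes U: "halfspace_measurable U" and \<Omega>: "open \<Omega>" and supp: "supp_subset U (tent \<Omega>)"
  obtains V where "V \<in> borel_measurable borel" "\<And>z. z \<notin> tent \<Omega> \<Longrightarrow> V z = 0"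
    "AE z in lborel. z \<in> upper_half \<longrightarrow> U z = V z"
proof -
  have "(\<lambda>z. if z \<in> upper_half then U z else 0) \<in> borel_measurable lebesgue"
    using U unfolding halfspace_measurable_def
    by (subst borel_measurable_if) auto
  then have re: "(\<lambda>z. Re (if z \<in> upper_half then U z else 0)) \<in> borel_measurable lebesgue"
    and im: "(\<lambda>z. Im (if z \<in> upper_half then U z else 0)) \<in> borel_measurable lebesgue"
    by (auto intro: borel_measurable_Re borel_measurable_Im)
  obtain f where f [measurable]: "f \<in> borel_measurable lborel"
    and ae_f: "AE z in lborel. Re (if z \<in> upper_half then U z else 0) = f z"
    using completion_ex_borel_measurable_real[OF re] by auto
  obtain g where g [measurable]: "g \<in> borel_measurable lborel"
    and ae_g: "AE z in lborel. Im (if z \<in> upper_half then U z else 0) = g z"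
    using completion_ex_borel_measurable_real[OF im] by auto
  define V where "V z = (if z \<in> tent \<Omega> then Complex (f z) (g z) else 0)" for z
  have [measurable]: "tent \<Omega> \<in> sets borel"
    by (rule tent_borel[OF \<Omega>])
  have "V = (\<lambda>z. if z \<in> tent \<Omega> then complex_of_real (f z) + \<i> * complex_of_real (g z) else 0)"
    by (auto simp: V_def complex_eq_iff)
  also have "\<dots> \<in> borel_measurable borel"
    using f g by measurable
  finally have V: "V \<in> borel_measurable borel" .
  have "AE z in lebesgue. z \<in> upper_half \<longrightarrow> z \<notin> tent \<Omega> \<longrightarrow> U z = 0"
    using supp unfolding supp_subset_def by (subst (asm) AE_restrict_space_iff) auto
  then have "AE z in lborel. z \<in> upper_half \<longrightarrow> z \<notin> tent \<Omega> \<longrightarrow> U z = 0"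
    by (simp add: AE_completion_iff)
  then have ae: "AE z in lborel. z \<in> upper_half \<longrightarrow> U z = V z"
    using ae_f ae_g by eventually_elim (auto simp: V_def complex_eq_iff)
  show thesis
    by (rule that[OF V _ ae]) (simp add: V_def)
qed

theorem theorem1p1:
  shows "\<exists>C::real. \<forall>(\<Omega> :: (real ^ 'n) set) (U :: (real ^ 'n) \<times> real \<Rightarrow> complex).
    open \<Omega> \<longrightarrow> U \<in> tent_space \<longrightarrow> supp_subset U (tent \<Omega>) \<longrightarrow>
    (\<exists>(K :: nat set) (lam :: nat \<Rightarrow> complex) (c :: nat \<Rightarrow> real ^ 'n) (r :: nat \<Rightarrow> real)
       (A :: nat \<Rightarrow> (real ^ 'n) \<times> real \<Rightarrow> complex).
       has_tent_sum (\<lambda>k z. lam k * A k z) U K \<and>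
       (\<lambda>k. cmod (lam k)) summable_on K \<and>
       (\<Sum>\<^sub>\<infinity>k\<in>K. cmod (lam k)) \<le> C * enn2real (tent_norm U) \<and>
       (\<forall>k\<in>K.
          0 < r k \<and>
          halfspace_measurable (A k) \<and>
          supp_subset (A k) (ball (c k) (r k) \<times> {0<..<6 * r k}) \<and>
          ball (c k) (5 * r k) \<subseteq> \<Omega> \<and>
          emeasure lebesgue (ball (c k) (r k)) *
            (\<integral>\<^sup>+ t \<in> {0<..}.
               (\<integral>\<^sup>+ y. ennreal ((cmod (A k (y, t)))\<^sup>2) \<partial>lebesgue) / ennreal t \<partial>lebesgue) = 1))"
proof -
  have "atomic_decomposition (decomposition_constant CARD('n)) \<Omega> U"
    if \<Omega>: "open \<Omega>" and U: "U \<in> tent_space" and supp: "supp_subset U (tent \<Omega>)"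
    for \<Omega> :: "(real ^ 'n) set" and U :: "(real ^ 'n) \<times> real \<Rightarrow> complex"
  proof -
    obtain V where V: "V \<in> borel_measurable borel" "\<And>z. z \<notin> tent \<Omega> \<Longrightarrow> V z = 0"
      and ae: "AE z in lborel. z \<in> upper_half \<longrightarrow> U z = V z"
      using borel_representative[OF _ \<Omega> supp] U by (auto simp: tent_space_def)
    have eq: "tent_norm U = tent_norm V"
      by (rule tent_norm_cong_AE[OF ae])
    then have "tent_norm V < \<infinity>"
      using U by (simp add: tent_space_def)
    then have "atomic_decomposition (decomposition_constant CARD('n)) \<Omega> V"
      using V by (intro atomic_decomposition_borel)
    then show ?thesis
      unfolding atomic_decomposition_def eq
      using has_tent_sum_cong_AE[OF _ U ae] by fast
  qed
  then show ?thesis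
    unfolding atomic_decomposition_def by blast
qed

end
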